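(* Let $p$ be a prime and $G$ a finite $p$-group. The group $H^1(\mathcal{A}_{\ge2}(G);\mathbb{Z})^{(G)}$ is isomorphic to the cohomology group $H^1(\mathcal{A}_{\ge2}(G)/G;\mathbb{Z})$, where $\mathcal{A}_{\ge2}(G)/G$ denotes the orbit space under the conjugation action.
   Context: $\mathcal{A}_{\ge2}(G)$ is the poset (under inclusion) of elementary abelian $p$-subgroups of $G$ of rank at least $2$, on which $G$ acts by conjugation; the orbit space is that of its topological realization (the order complex). The group $H^1(\mathcal{A}_{\ge2}(G);\mathbb{Z})^{(G)}$ is defined as the quotient $Z^1/B^1$, where $Z^1$ is the group of $G$-invariant simplicial $1$-cocycles (with values in $\mathbb{Z}$) of the order complex of $\mathcal{A}_{\ge2}(G)$ and $B^1$ is the subgroup of coboundaries of $G$-invariant $0$-cochains. *)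

theory Defs
  imports "HOL-Homology.Homology" "HOL-Algebra.Group_Action"
    "HOL-Computational_Algebra.Primes"
begin

definition cochain_cohomology ::
    "(nat \<Rightarrow> 'c monoid) \<Rightarrow> (nat \<Rightarrow> 'c \<Rightarrow> 'c) \<Rightarrow> nat \<Rightarrow> 'c set monoid" where
  "cochain_cohomology C d n =
     (C n)\<lparr>carrier := kernel (C n) (C (Suc n)) (d n)\<rparr>
       Mod (case n of 0 \<Rightarrow> {\<one>\<^bsub>C 0\<^esub>} | Suc m \<Rightarrow> d m ` carrier (C m))"


text \<open>Singular cohomology with integer coefficients. A cochain is given by its values on
  the singular simplices, i.e. on the basis of the free abelian group \<^const>\<open>chain_group\<close>;
  the coboundary is dual to \<^const>\<open>chain_boundary\<close>.\<close>

definition singular_cochain_group ::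
    "'x topology \<Rightarrow> nat \<Rightarrow> (((nat \<Rightarrow> real) \<Rightarrow> 'x) \<Rightarrow> int) monoid" where
  "singular_cochain_group X n = product_group (singular_simplex_set n X) (\<lambda>_. integer_group)"

definition singular_coboundary ::
    "'x topology \<Rightarrow> nat \<Rightarrow> (((nat \<Rightarrow> real) \<Rightarrow> 'x) \<Rightarrow> int) \<Rightarrow> ((nat \<Rightarrow> real) \<Rightarrow> 'x) \<Rightarrow> int" where
  "singular_coboundary X n c =
     (\<lambda>\<sigma> \<in> singular_simplex_set (Suc n) X. \<Sum>k\<le>Suc n. (-1) ^ k * c (singular_face (Suc n) k \<sigma>))"

definition singular_cohomology ::
    "nat \<Rightarrow> 'x topology \<Rightarrow> (((nat \<Rightarrow> real) \<Rightarrow> 'x) \<Rightarrow> int) set monoid" where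
  "singular_cohomology n X =
     cochain_cohomology (singular_cochain_group X) (singular_coboundary X) n"


text \<open>The order complex of a poset \<open>P\<close>. An \<open>n\<close>-simplex is a chain of \<open>n + 1\<close> elements, listed
  in increasing order; this fixes its orientation, and monotone actions respect it.\<close>

definition order_simplices :: "'v::order set \<Rightarrow> nat \<Rightarrow> 'v list set" where
  "order_simplices P n = {\<sigma>. length \<sigma> = Suc n \<and> set \<sigma> \<subseteq> P \<and> sorted_wrt (<) \<sigma>}"

definition order_face :: "nat \<Rightarrow> 'v list \<Rightarrow> 'v list" where
  "order_face k \<sigma> = take k \<sigma> @ drop (Suc k) \<sigma>"

definition order_coboundary ::
    "'v::order set \<Rightarrow> nat \<Rightarrow> ('v list \<Rightarrow> int) \<Rightarrow> 'v list \<Rightarrow> int" where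
  "order_coboundary P n f =
     (\<lambda>\<sigma> \<in> order_simplices P (Suc n). \<Sum>k\<le>Suc n. (-1) ^ k * f (order_face k \<sigma>))"

definition invariant_order_cochain_group ::
    "('g, 'b) monoid_scheme \<Rightarrow> ('g \<Rightarrow> 'v::order \<Rightarrow> 'v) \<Rightarrow> 'v set \<Rightarrow> nat \<Rightarrow> ('v list \<Rightarrow> int) monoid" where
  "invariant_order_cochain_group G \<phi> P n =
     (product_group (order_simplices P n) (\<lambda>_. integer_group))
       \<lparr>carrier := {f \<in> order_simplices P n \<rightarrow>\<^sub>E UNIV.
                      \<forall>g \<in> carrier G. \<forall>\<sigma> \<in> order_simplices P n. f (map (\<phi> g) \<sigma>) = f \<sigma>}\<rparr>"

definition invariant_order_cohomology ::
    "('g, 'b) monoid_scheme \<Rightarrow> ('g \<Rightarrow> 'v::order \<Rightarrow> 'v) \<Rightarrow> nat \<Rightarrow> 'v set \<Rightarrow> ('v list \<Rightarrow> int) set monoid"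
  where
  "invariant_order_cohomology G \<phi> n P =
     cochain_cohomology (invariant_order_cochain_group G \<phi> P) (order_coboundary P) n"


text \<open>Points of the realization are given by their barycentric coordinates. The topology is that
  of coordinatewise convergence, which for finite \<open>P\<close> (the only case used) is the usual weak
  topology of the simplicial complex.\<close>

definition order_realization :: "'v::order set \<Rightarrow> ('v \<Rightarrow> real) topology" where
  "order_realization P = subtopology (powertop_real P)
     {t. (\<forall>v \<in> P. 0 \<le> t v) \<and>
         finite {v \<in> P. t v \<noteq> 0} \<and>
         (\<forall>v \<in> P. \<forall>w \<in> P. t v \<noteq> 0 \<and> t w \<noteq> 0 \<longrightarrow> v \<le> w \<or> w \<le> v) \<and>
         (\<Sum>v | v \<in> P \<and> t v \<noteq> 0. t v) = 1}"

text \<open>The linear extension of an action on \<open>P\<close>: the vertex \<open>v\<close> is moved to \<open>\<phi> g v\<close>.\<close>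

definition realization_action ::
    "('g, 'b) monoid_scheme \<Rightarrow> ('g \<Rightarrow> 'v \<Rightarrow> 'v) \<Rightarrow> 'v set \<Rightarrow> 'g \<Rightarrow> ('v \<Rightarrow> real) \<Rightarrow> 'v \<Rightarrow> real" where
  "realization_action G \<phi> P g t = (\<lambda>v \<in> P. t (\<phi> (inv\<^bsub>G\<^esub> g) v))"

definition orbit_space ::
    "('g, 'b) monoid_scheme \<Rightarrow> ('g \<Rightarrow> 'x \<Rightarrow> 'x) \<Rightarrow> 'x topology \<Rightarrow> 'x set topology" where
  "orbit_space G \<phi> X = topology (\<lambda>U. U \<subseteq> orbits G (topspace X) \<phi> \<and>
     openin X {x \<in> topspace X. orbit G \<phi> x \<in> U})"

lemma openin_orbit_space:
  "openin (orbit_space G \<phi> X) U \<longleftrightarrow>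
     U \<subseteq> orbits G (topspace X) \<phi> \<and> openin X {x \<in> topspace X. orbit G \<phi> x \<in> U}"
proof -
  have "istopology (\<lambda>U. U \<subseteq> orbits G (topspace X) \<phi> \<and>
          openin X {x \<in> topspace X. orbit G \<phi> x \<in> U})"
    unfolding istopology_def
  proof (intro conjI allI impI; (elim conjE)?)
    fix S T
    assume "openin X {x \<in> topspace X. orbit G \<phi> x \<in> S}" "openin X {x \<in> topspace X. orbit G \<phi> x \<in> T}"
    then have "openin X ({x \<in> topspace X. orbit G \<phi> x \<in> S} \<inter> {x \<in> topspace X. orbit G \<phi> x \<in> T})"
      by (rule openin_Int)
    then show "openin X {x \<in> topspace X. orbit G \<phi> x \<in> S \<inter> T}"
      by (rule back_subst[of "openin X"]) auto
  next
    fix K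
    assume K: "\<forall>U\<in>K. U \<subseteq> orbits G (topspace X) \<phi> \<and> openin X {x \<in> topspace X. orbit G \<phi> x \<in> U}"
    have "openin X (\<Union>U\<in>K. {x \<in> topspace X. orbit G \<phi> x \<in> U})"
      using K by blast
    then show "openin X {x \<in> topspace X. orbit G \<phi> x \<in> \<Union>K}"
      by (rule back_subst[of "openin X"]) auto
  qed auto
  then show ?thesis
    by (simp add: orbit_space_def topology_inverse')
qed

lemma topspace_orbit_space: "topspace (orbit_space G \<phi> X) = orbits G (topspace X) \<phi>"
proof
  show "topspace (orbit_space G \<phi> X) \<subseteq> orbits G (topspace X) \<phi>"
    using openin_orbit_space openin_topspace by blast
  have "{x \<in> topspace X. orbit G \<phi> x \<in> orbits G (topspace X) \<phi>} = topspace X"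
    by (auto simp: orbits_def)
  then have "openin (orbit_space G \<phi> X) (orbits G (topspace X) \<phi>)"
    by (simp add: openin_orbit_space)
  then show "orbits G (topspace X) \<phi> \<subseteq> topspace (orbit_space G \<phi> X)"
    by (rule openin_subset)
qed

lemma quotient_map_orbit: "quotient_map X (orbit_space G \<phi> X) (orbit G \<phi>)"
  unfolding quotient_map_def topspace_orbit_space openin_orbit_space
  by (auto simp: orbits_def)


definition elementary_abelian_of_rank :: "nat \<Rightarrow> nat \<Rightarrow> ('a, 'b) monoid_scheme \<Rightarrow> bool" where
  "elementary_abelian_of_rank p r E \<longleftrightarrow>
     E \<cong> product_group {..<r} (\<lambda>_. integer_mod_group p)"

definition elementary_abelian_subgroups_ge2 ::
    "('a, 'b) monoid_scheme \<Rightarrow> nat \<Rightarrow> 'a set set" where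
  "elementary_abelian_subgroups_ge2 G p =
     {E. subgroup E G \<and> (\<exists>r\<ge>2. elementary_abelian_of_rank p r (G\<lparr>carrier := E\<rparr>))}"

definition conjugate_set :: "('a, 'b) monoid_scheme \<Rightarrow> 'a \<Rightarrow> 'a set \<Rightarrow> 'a set" where
  "conjugate_set G g E = g <#\<^bsub>G\<^esub> E #>\<^bsub>G\<^esub> (inv\<^bsub>G\<^esub> g)"

end

theory Submission
  imports Defs "HOL-Analysis.Further_Topology" "HOL-Analysis.Abstract_Topological_Spaces"
begin

text \<open>
  The statement holds for every group action by order automorphisms on a finite poset \<open>P\<close>, with
  \<open>X\<close> the orbit space of the realization \<open>K\<close>. Distinct points of one orbit of \<open>P\<close> are incomparable, because
  an automorphism preserves the finite cardinality of lower sets. Hence a chain meets every orbit at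
  most once, no simplex is folded onto itself, and \<open>X\<close> is assembled from one cell for each orbit of
  chains. Evaluating singular cochains of \<open>X\<close> on the characteristic maps of these cells is therefore
  a cochain map to the invariant simplicial cochains (\<open>restrict_cochain_coboundary\<close>). In degree one
  it induces an isomorphism on cohomology, by two direct arguments that do without excision.

  \<^emph>\<open>Surjectivity\<close> (\<open>cocycle_with_given_edges\<close>). First integral cohomology is represented by the
  circle. An invariant simplicial cocycle \<open>f\<close> yields a map from \<open>X\<close> to the circle that sends all
  vertices to \<open>1\<close> and winds \<open>f [v, w]\<close> times along the edge \<open>[v, w]\<close>: on the open star of a vertex
  \<open>v\<close> its angle is the affine function with value \<open>f [v, w]\<close> at \<open>w\<close>, and the cocycle condition says
  that two base vertices give angles that differ by an integer. Pulling back the standard singular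
  cocycle of the circle, which measures increments of lifted angles (\<open>circle_cochain\<close>), gives a
  singular cocycle that restricts to \<open>f\<close>.

  \<^emph>\<open>Injectivity\<close> (\<open>cocycle_is_coboundary_if_edges\<close>). Let the singular cocycle \<open>c\<close> restrict to the
  coboundary of an invariant function on vertices. Its potential is extended from the vertices to
  all of \<open>X\<close> by adding the value of \<open>c\<close> on straight paths from a vertex of the carrying simplex; by
  the cocycle condition on triangles it does not matter which vertex is used. The image in \<open>X\<close> of the
  open star of \<open>v\<close> contracts to the centre along such straight paths, which is well defined because
  an element that relates two points of the star fixes \<open>v\<close>. So \<open>c\<close> is the coboundary of the potential
  on all paths that stay in such an open set, and by additivity and compactness on all paths.
\<close>

section \<open>Subquotients of groups of integer-valued functions\<close>

text \<open>The composite of \<open>h\<close> with the projection onto \<open>H Mod M\<close> is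
onto and has kernel \<open>N\<close>, so the first isomorphism theorem applies.\<close>

lemma Mod_iso_Mod:
  assumes "normal N G" "normal M H" and h: "h \<in> hom G H"
    and surj: "h ` carrier G = carrier H"
    and iff: "\<And>x. x \<in> carrier G \<Longrightarrow> h x \<in> M \<longleftrightarrow> x \<in> N"
  shows "G Mod N \<cong> H Mod M"
proof -
  interpret N: normal N G by fact
  interpret M: normal M H by fact
  let ?k = "\<lambda>x. M #>\<^bsub>H\<^esub> h x"
  have hom: "?k \<in> hom G (H Mod M)"
    using hom_compose[OF h M.r_coset_hom_Mod] by (simp add: o_def)
  interpret k: group_hom G "H Mod M" ?k
    by (intro group_hom.intro group_hom_axioms.intro hom M.factorgroup_is_group N.group_axioms)
  have hx: "h x \<in> carrier H" if "x \<in> carrier G" for x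
    using surj that by blast
  have "?k ` carrier G = carrier (H Mod M)"
    unfolding FactGroup_def RCOSETS_def surj[symmetric] by auto
  moreover have "kernel G (H Mod M) ?k = N"
  proof -
    have "?k x = M \<longleftrightarrow> x \<in> N" if "x \<in> carrier G" for x
      using iff[OF that] M.coset_join1[OF _ hx[OF that] M.subgroup_axioms] M.coset_join2[OF hx[OF that] M.subgroup_axioms]
      by blast
    then show ?thesis
      using N.subset by (auto simp: kernel_def FactGroup_def)
  qed
  ultimately show ?thesis
    using k.FactGroup_iso by simp
qed

abbreviation integer_functions :: "'i set \<Rightarrow> ('i \<Rightarrow> int) monoid" where
  "integer_functions I \<equiv> product_group I (\<lambda>_. integer_group)"

lemma integer_functions_simps:
  "carrier (integer_functions I) = I \<rightarrow>\<^sub>E UNIV"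
  "x \<otimes>\<^bsub>integer_functions I\<^esub> y = (\<lambda>i\<in>I. x i + y i)"
  "\<one>\<^bsub>integer_functions I\<^esub> = (\<lambda>i\<in>I. 0)"
  by (simp_all add: integer_group_def)

lemma comm_group_integer_functions: "comm_group (integer_functions I)"
  by (rule group.group_comm_groupI) (simp, simp only: integer_functions_simps add.commute)

lemma normal_integer_functions:
  assumes "subgroup N (integer_functions I)" "subgroup Z (integer_functions I)" "N \<subseteq> Z"
  shows "normal N ((integer_functions I)\<lparr>carrier := Z\<rparr>)"
proof -
  interpret comm_group "integer_functions I" by (rule comm_group_integer_functions)
  show ?thesis
    using assms by (simp add: normal_restrict_supergroup subgroup_imp_normal)
qed

text \<open>Both coboundary operators have this shape, with \<open>F k\<close> the
\<open>k\<close>-th face and \<open>a k\<close> its sign.\<close>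

lemma hom_alternating_sum:
  assumes "\<And>k \<sigma>. k \<in> K \<Longrightarrow> \<sigma> \<in> J \<Longrightarrow> F k \<sigma> \<in> I"
  shows "(\<lambda>f. \<lambda>\<sigma>\<in>J. \<Sum>k\<in>K. a k * f (F k \<sigma>)) \<in> hom (integer_functions I) (integer_functions J)"
proof (rule homI, unfold integer_functions_simps)
  fix f g
  have "(\<Sum>k\<in>K. a k * (\<lambda>i\<in>I. f i + g i) (F k \<sigma>)) = (\<Sum>k\<in>K. a k * f (F k \<sigma>)) + (\<Sum>k\<in>K. a k * g (F k \<sigma>))"
    if "\<sigma> \<in> J" for \<sigma>
    unfolding sum.distrib[symmetric] using assms[OF _ that] by (intro sum.cong) (simp_all add: distrib_left)
  then show "(\<lambda>\<sigma>\<in>J. \<Sum>k\<in>K. a k * (\<lambda>i\<in>I. f i + g i) (F k \<sigma>)) =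
      (\<lambda>\<sigma>\<in>J. (\<lambda>\<sigma>\<in>J. \<Sum>k\<in>K. a k * f (F k \<sigma>)) \<sigma> + (\<lambda>\<sigma>\<in>J. \<Sum>k\<in>K. a k * g (F k \<sigma>)) \<sigma>)"
    by (simp add: fun_eq_iff restrict_def)
qed simp

section \<open>Affine singular simplices of dimension at most two\<close>

text \<open>The map \<open>H\<close> along the straight segment from \<open>a\<close> to
\<open>b\<close>, as a singular simplex. Working with a map \<open>H\<close> on a convex set and
its affine simplices replaces explicit subdivisions and prisms by identities between
segments.\<close>

definition line_simplex :: "('v::real_vector \<Rightarrow> 'x) \<Rightarrow> 'v \<Rightarrow> 'v \<Rightarrow> (nat \<Rightarrow> real) \<Rightarrow> 'x" where
  "line_simplex H a b = (\<lambda>x \<in> standard_simplex 1. H (x 0 *\<^sub>R a + x 1 *\<^sub>R b))"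

definition triangle_simplex :: "('v::real_vector \<Rightarrow> 'x) \<Rightarrow> 'v \<Rightarrow> 'v \<Rightarrow> 'v \<Rightarrow> (nat \<Rightarrow> real) \<Rightarrow> 'x" where
  "triangle_simplex H a b d = (\<lambda>x \<in> standard_simplex 2. H (x 0 *\<^sub>R a + x 1 *\<^sub>R b + x 2 *\<^sub>R d))"

definition point_simplex :: "'x \<Rightarrow> (nat \<Rightarrow> real) \<Rightarrow> 'x" where
  "point_simplex y = (\<lambda>x \<in> standard_simplex 0. y)"

lemma standard_simplex_1D:
  assumes "x \<in> standard_simplex 1" shows "0 \<le> x 0" "0 \<le> x 1" "x 0 + x 1 = 1"
  using assms by (auto simp: standard_simplex_def)

lemma standard_simplex_2D:
  assumes "x \<in> standard_simplex 2" shows "0 \<le> x 0" "0 \<le> x 1" "0 \<le> x 2" "x 0 + x 1 + x 2 = 1"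
  using assms by (auto simp: standard_simplex_def numeral_2_eq_2)

text \<open>Two affine segments give the same singular simplex as soon as they agree as
parametrised paths; this identifies segments drawn in different convex sets.\<close>

lemma line_simplex_eqI:
  assumes "\<And>s. 0 \<le> s \<Longrightarrow> s \<le> 1 \<Longrightarrow> H ((1 - s) *\<^sub>R a + s *\<^sub>R b) = H' ((1 - s) *\<^sub>R a' + s *\<^sub>R b')"
  shows "line_simplex H a b = line_simplex H' a' b'"
proof -
  have "H (x 0 *\<^sub>R a + x 1 *\<^sub>R b) = H' (x 0 *\<^sub>R a' + x 1 *\<^sub>R b')" if "x \<in> standard_simplex 1" for x
  proof -
    have "x 0 = 1 - x 1" using standard_simplex_1D[OF that] by simp
    then show ?thesis using assms[of "x 1"] standard_simplex_1D[OF that] by simp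
  qed
  then show ?thesis by (simp add: line_simplex_def fun_eq_iff restrict_def)
qed

lemma singular_simplex_euclidean_iff:
  "singular_simplex n X f \<longleftrightarrow>
    continuous_map (top_of_set (standard_simplex n)) X f \<and> f \<in> extensional (standard_simplex n)"
  by (simp add: singular_simplex_def euclidean_product_topology)

lemma singular_simplex_point: "y \<in> topspace X \<Longrightarrow> singular_simplex 0 X (point_simplex y)"
  unfolding singular_simplex_euclidean_iff
  by (auto simp: point_simplex_def intro: continuous_map_eq[of _ _ "\<lambda>_. y"])

lemma singular_simplex_compose_restrict:
  assumes H: "continuous_map (top_of_set S) X H"
    and L: "continuous_on (standard_simplex n) L" "L ` standard_simplex n \<subseteq> S"
  shows "singular_simplex n X (\<lambda>x \<in> standard_simplex n. H (L x))"
proof -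
  have "continuous_map (top_of_set (standard_simplex n)) (top_of_set S) L"
    using L by (auto simp: continuous_map_in_subtopology)
  from continuous_map_compose[OF this H] show ?thesis
    unfolding singular_simplex_euclidean_iff
    by (auto intro: continuous_map_eq)
qed

lemma singular_simplex_line:
  assumes "continuous_map (top_of_set S) X H" "convex S" "a \<in> S" "b \<in> S"
  shows "singular_simplex 1 X (line_simplex H (a::'v::real_normed_vector) b)"
  unfolding line_simplex_def
proof (rule singular_simplex_compose_restrict[OF assms(1)])
  show "continuous_on (standard_simplex 1) (\<lambda>x. x 0 *\<^sub>R a + x 1 *\<^sub>R b)"
    by (intro continuous_intros continuous_on_subset[OF continuous_on_product_coordinates]) auto
  show "(\<lambda>x. x 0 *\<^sub>R a + x 1 *\<^sub>R b) ` standard_simplex 1 \<subseteq> S"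
    using standard_simplex_1D assms(2-4) by (auto intro!: convexD)
qed

lemma convex_three:
  assumes "convex S" "a \<in> S" "b \<in> S" "d \<in> S" "0 \<le> u" "0 \<le> v" "0 \<le> w" "u + v + w = 1"
  shows "u *\<^sub>R a + v *\<^sub>R b + w *\<^sub>R d \<in> S"
proof -
  have "u *\<^sub>R a + v *\<^sub>R b + w *\<^sub>R d \<in> convex hull {a, b, d}"
    unfolding convex_hull_3 using assms by blast
  moreover have "convex hull {a, b, d} \<subseteq> S"
    using assms by (intro hull_minimal) auto
  ultimately show ?thesis by blast
qed

lemma singular_simplex_triangle:
  assumes "continuous_map (top_of_set S) X H" "convex S" "a \<in> S" "b \<in> S" "d \<in> S"
  shows "singular_simplex 2 X (triangle_simplex H (a::'v::real_normed_vector) b d)"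
  unfolding triangle_simplex_def
proof (rule singular_simplex_compose_restrict[OF assms(1)])
  show "continuous_on (standard_simplex 2) (\<lambda>x. x 0 *\<^sub>R a + x 1 *\<^sub>R b + x 2 *\<^sub>R d)"
    by (intro continuous_intros continuous_on_subset[OF continuous_on_product_coordinates]) auto
  show "(\<lambda>x. x 0 *\<^sub>R a + x 1 *\<^sub>R b + x 2 *\<^sub>R d) ` standard_simplex 2 \<subseteq> S"
    using standard_simplex_2D assms(2-5) by (auto intro!: convex_three)
qed

lemma faces_of_triangle:
  "singular_face 2 0 (triangle_simplex H a b d) = line_simplex H b d"
  "singular_face 2 1 (triangle_simplex H a b d) = line_simplex H a d"
  "singular_face 2 2 (triangle_simplex H a b d) = line_simplex H a b"
  unfolding triangle_simplex_def line_simplex_def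
  by (simp_all, simp_all add: singular_face_def simplical_face_def o_def)

lemma faces_of_line:
  "singular_face 1 0 (line_simplex H a b) = point_simplex (H b)"
  "singular_face 1 1 (line_simplex H a b) = point_simplex (H a)"
proof -
  have [simp]: "x 0 = 1" if "x \<in> standard_simplex 0" for x
    using that by (simp add: standard_simplex_0)
  have "singular_face 1 0 (line_simplex H a b) = (\<lambda>x \<in> standard_simplex 0. H (x 0 *\<^sub>R b))"
    "singular_face 1 1 (line_simplex H a b) = (\<lambda>x \<in> standard_simplex 0. H (x 0 *\<^sub>R a))"
    unfolding line_simplex_def 
    by (simp_all del: One_nat_def, simp_all add: singular_face_def simplical_face_def o_def)
  then show "singular_face 1 0 (line_simplex H a b) = point_simplex (H b)"
    "singular_face 1 1 (line_simplex H a b) = point_simplex (H a)"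
    by (simp_all add: point_simplex_def restrict_def fun_eq_iff)
qed

lemma singular_coboundary_line:
  assumes "continuous_map (top_of_set S) X H" "convex S" "a \<in> S" "b \<in> S"
  shows "singular_coboundary X 0 c (line_simplex H (a::'v::real_normed_vector) b) =
    c (point_simplex (H b)) - c (point_simplex (H a))"
  using singular_simplex_line[OF assms] faces_of_line[of H a b]
  by (simp add: singular_coboundary_def)


text \<open>Precomposition with the affine bijection \<open>[0,1] \<rightarrow> standard_simplex
1\<close> turns a singular simplex, whose domain lies in a function space, into a path on a subset
of a normed space, where path lifting and convexity are available.\<close>

lemma singular_1_simplex_as_line:
  assumes "singular_simplex 1 X \<sigma>"
  obtains H :: "real \<Rightarrow> 'x" where "continuous_map (top_of_set {0..1}) X H" "\<sigma> = line_simplex H 0 1"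
proof
  let ?p = "\<lambda>s i. if i = 0 then 1 - s else if i = Suc 0 then s else (0::real)"
  have p: "?p s \<in> standard_simplex 1" if "s \<in> {0..1}" for s
    using that by (auto simp: standard_simplex_def)
  have "continuous_map (top_of_set {0..1}) (top_of_set (standard_simplex 1)) ?p"
    unfolding continuous_map_in_subtopology
  proof
    show "continuous_map (top_of_set {0..1}) euclidean ?p"
      unfolding continuous_map_iff_continuous
    proof (rule continuous_on_coordinatewise_then_product)
      fix i :: nat show "continuous_on {0..1} (\<lambda>z. ?p z i)"
        by (cases "i = 0"; cases "i = 1") (auto intro!: continuous_intros)
    qed
  qed (use p in auto)
  then show "continuous_map (top_of_set {0..1}) X (\<sigma> \<circ> ?p)"
    using assms unfolding singular_simplex_euclidean_iff by (blast intro: continuous_map_compose)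
  have "?p (x 1) = x" if "x \<in> standard_simplex 1" for x
    using that by (auto simp: standard_simplex_def fun_eq_iff)
  moreover have "\<sigma> x = undefined" if "x \<notin> standard_simplex 1" for x
    using assms that by (auto simp: singular_simplex_euclidean_iff extensional_def)
  ultimately have "\<sigma> x = (\<lambda>x \<in> standard_simplex 1. (\<sigma> \<circ> ?p) (x 1)) x" for x
    unfolding restrict_def comp_apply by (cases "x \<in> standard_simplex 1") (simp_all only: if_True if_False)
  then have "\<sigma> = (\<lambda>x \<in> standard_simplex 1. (\<sigma> \<circ> ?p) (x 1))" by (rule ext)
  then show "\<sigma> = line_simplex (\<sigma> \<circ> ?p) 0 1"
    by (simp add: line_simplex_def)
qed

lemma convex_triangle: "convex {z::real \<times> real. 0 \<le> fst z \<and> 0 \<le> snd z \<and> fst z + snd z \<le> 1}"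
proof (rule convexI)
  fix x y :: "real \<times> real" and u v :: real
  assume "x \<in> {z. 0 \<le> fst z \<and> 0 \<le> snd z \<and> fst z + snd z \<le> 1}"
    "y \<in> {z. 0 \<le> fst z \<and> 0 \<le> snd z \<and> fst z + snd z \<le> 1}" "0 \<le> u" "0 \<le> v" "u + v = 1"
  moreover from this have "u * (fst x + snd x) + v * (fst y + snd y) \<le> 1"
    by (intro convex_bound_le) auto
  ultimately show "u *\<^sub>R x + v *\<^sub>R y \<in> {z. 0 \<le> fst z \<and> 0 \<le> snd z \<and> fst z + snd z \<le> 1}"
    by (simp add: algebra_simps)
qed

lemma singular_2_simplex_as_triangle:
  assumes "singular_simplex 2 X \<sigma>"
  obtains H :: "real \<times> real \<Rightarrow> 'x"
  where "continuous_map (top_of_set {z. 0 \<le> fst z \<and> 0 \<le> snd z \<and> fst z + snd z \<le> 1}) X H"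
    "\<sigma> = triangle_simplex H (0,0) (1,0) (0,1)"
proof
  let ?p = "\<lambda>z (i::nat). if i = 0 then 1 - fst z - snd z else if i = 1 then fst z
      else if i = 2 then snd z else (0::real)"
  let ?T = "{z::real \<times> real. 0 \<le> fst z \<and> 0 \<le> snd z \<and> fst z + snd z \<le> 1}"
  have p: "?p z \<in> standard_simplex 2" if "z \<in> ?T" for z
    using that by (auto simp: standard_simplex_def numeral_2_eq_2)
  have "continuous_map (top_of_set ?T) (top_of_set (standard_simplex 2)) ?p"
    unfolding continuous_map_in_subtopology
  proof
    show "continuous_map (top_of_set ?T) euclidean ?p"
      unfolding continuous_map_iff_continuous
    proof (rule continuous_on_coordinatewise_then_product)
      fix i show "continuous_on ?T (\<lambda>z. ?p z i)"
        by (cases "i = 0"; cases "i = 1"; cases "i = 2") (auto intro!: continuous_intros)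
    qed
  qed (use p in auto)
  then show "continuous_map (top_of_set ?T) X (\<sigma> \<circ> ?p)"
    using assms unfolding singular_simplex_euclidean_iff by (blast intro: continuous_map_compose)
  have "?p (x 1, x 2) = x" if "x \<in> standard_simplex 2" for x
  proof
    fix i show "?p (x 1, x 2) i = x i"
      using that standard_simplex_2D[OF that] by (cases "i > 2") (auto simp: standard_simplex_def numeral_2_eq_2 less_Suc_eq not_less_eq)
  qed
  moreover have "\<sigma> x = undefined" if "x \<notin> standard_simplex 2" for x
    using assms that by (auto simp: singular_simplex_euclidean_iff extensional_def)
  ultimately have "\<sigma> x = (\<lambda>x \<in> standard_simplex 2. (\<sigma> \<circ> ?p) (x 1, x 2)) x" for x
    unfolding restrict_def comp_apply by (cases "x \<in> standard_simplex 2") (simp_all only: if_True if_False)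
  then have "\<sigma> = (\<lambda>x \<in> standard_simplex 2. (\<sigma> \<circ> ?p) (x 1, x 2))" by (rule ext)
  then show "\<sigma> = triangle_simplex (\<sigma> \<circ> ?p) (0,0) (1,0) (0,1)"
    by (simp add: triangle_simplex_def)
qed

text \<open>The cocycle condition on the faces of singular \<open>2\<close>-simplices, stated for
arbitrary functions, whether or not they are extensional.\<close>

definition singular_1_cocycle :: "'x topology \<Rightarrow> (((nat \<Rightarrow> real) \<Rightarrow> 'x) \<Rightarrow> int) \<Rightarrow> bool" where
  "singular_1_cocycle X c \<longleftrightarrow> (\<forall>\<tau>. singular_simplex 2 X \<tau> \<longrightarrow>
     c (singular_face 2 0 \<tau>) + c (singular_face 2 2 \<tau>) = c (singular_face 2 1 \<tau>))"

text \<open>The cocycle condition on the affine triangle \<open>a, b, d\<close>. Paths are cut and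
composed by means of this rule, without reparametrisation.\<close>

lemma singular_1_cocycle_line_add:
  assumes "singular_1_cocycle X c"
    and "continuous_map (top_of_set S) X H" "convex S" "a \<in> S" "b \<in> S" "d \<in> S"
  shows "c (line_simplex H (a::'v::real_normed_vector) b) + c (line_simplex H b d) = c (line_simplex H a d)"
  using assms(1) singular_simplex_triangle[OF assms(2-)] faces_of_triangle[of H a b d]
  by (force simp: singular_1_cocycle_def)

lemma singular_1_cocycle_const:
  assumes "singular_1_cocycle X c"
    and "continuous_map (top_of_set S) X H" "convex S" "(a::'v::real_normed_vector) \<in> S"
  shows "c (line_simplex H a a) = 0"
  using singular_1_cocycle_line_add[OF assms assms(4) assms(4)] by simp

text \<open>Along a homotopy whose initial stage is constant, the value of \<open>c\<close> on the
final path is the difference of its values on the two sides: add up \<open>c\<close> along the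
boundary of the square, where the edge on which the homotopy is constant contributes
nothing.\<close>

lemma singular_1_cocycle_homotopy:
  fixes H :: "real \<times> real \<Rightarrow> 'x"
  assumes c: "singular_1_cocycle X c" 
    and H: "continuous_map (top_of_set ({0..1} \<times> {l..u})) X H"
    and ab: "a \<in> {l..u}" "b \<in> {l..u}" 
    and base: "\<And>t. t \<in> {l..u} \<Longrightarrow> H (0, t) = y"
  shows "c (line_simplex (\<lambda>t. H (1, t)) a b) =
      c (line_simplex (\<lambda>s. H (s, b)) 0 1) - c (line_simplex (\<lambda>s. H (s, a)) (0::real) 1)"
proof -
  let ?S = "{0..1::real} \<times> {l..u}"
  have S: "convex ?S" by (intro convex_Times convex_real_interval)
  have "c (line_simplex H (0,a) (1,a)) + c (line_simplex H (1,a) (1,b)) = 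
      c (line_simplex H (0,a) (0,b)) + c (line_simplex H (0,b) (1,b))"
    using singular_1_cocycle_line_add[OF c H S] ab by simp
  moreover have "line_simplex H (0,a) (0,b) = line_simplex H (0,a) (0,a)"
  proof (rule line_simplex_eqI)
    fix s :: real assume "0 \<le> s" "s \<le> 1"
    then have "(1 - s) * a + s * b \<in> {l..u}"
      using ab convexD_alt[of "{l..u}" a b s] by (auto simp: algebra_simps)
    then show "H ((1 - s) *\<^sub>R (0, a) + s *\<^sub>R (0, b)) = H ((1 - s) *\<^sub>R (0, a) + s *\<^sub>R (0, a))"
      using ab base by (simp add: algebra_simps)
  qed
  then have "c (line_simplex H (0,a) (0,b)) = 0"
    using singular_1_cocycle_const[OF c H S, of "(0,a)"] ab by simp
  moreover have "line_simplex H (0,t) (1,t) = line_simplex (\<lambda>s. H (s, t)) (0::real) 1" for t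
    by (rule line_simplex_eqI) (simp add: algebra_simps)
  moreover have "line_simplex H (1,a) (1,b) = line_simplex (\<lambda>t. H (1, t)) a b"
    by (rule line_simplex_eqI) (simp add: algebra_simps)
  ultimately show ?thesis by simp
qed

section \<open>Potentials of singular cocycles\<close>

text \<open>A cocycle that has the potential \<open>\<beta>\<close> on all short paths has it on
every path: both sides are additive under concatenation of subintervals, so the compactness of
\<open>[0,1]\<close>, in the form of Bolzano's bisection principle, passes from short subintervals
to the whole path.\<close>

lemma locally_coboundary_imp_coboundary:
  fixes c :: "((nat \<Rightarrow> real) \<Rightarrow> 'x) \<Rightarrow> int"
  assumes c: "singular_1_cocycle X c"
    and loc: "\<And>y. y \<in> topspace X \<Longrightarrow> \<exists>U. openin X U \<and> y \<in> U \<and>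
      (\<forall>l u H. l \<le> u \<longrightarrow> continuous_map (top_of_set {l..u}) X H \<longrightarrow> H ` {l..u} \<subseteq> U \<longrightarrow>
         c (line_simplex H (l::real) u) = \<beta> (H u) - \<beta> (H l))"
    and H: "continuous_map (top_of_set {0..1::real}) X H"
  shows "c (line_simplex H 0 1) = \<beta> (H 1) - \<beta> (H 0)"
proof -
  \<comment> \<open>The side conditions confine the bisection to subintervals of the domain of the path.\<close>
  define Q where "Q a b \<longleftrightarrow> (0 \<le> a \<longrightarrow> b \<le> 1 \<longrightarrow> a \<le> b \<longrightarrow> c (line_simplex H a b) = \<beta> (H b) - \<beta> (H a))" for a b
  have "Q 0 1"
  proof (rule Bolzano[of 0 1 Q])
    fix a b d assume Q: "Q a b" "Q b d" and ab: "a \<le> b" "b \<le> d"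
    show "Q a d"
      unfolding Q_def
    proof (intro impI)
      assume "0 \<le> a" "d \<le> 1" "a \<le> d"
      with ab have "a \<in> {0..1}" "b \<in> {0..1}" "d \<in> {0..1}" by auto
      from singular_1_cocycle_line_add[OF c H convex_real_interval(5) this]
      show "c (line_simplex H a d) = \<beta> (H d) - \<beta> (H a)"
        using Q ab \<open>0 \<le> a\<close> \<open>d \<le> 1\<close> by (simp add: Q_def)
    qed
  next
    fix x :: real assume x: "0 \<le> x" "x \<le> 1"
    then have "H x \<in> topspace X" using H by (auto simp: continuous_map_def)
    from loc[OF this] obtain U where U: "openin X U" "H x \<in> U"
      and cU: "\<And>l u H. l \<le> u \<Longrightarrow> continuous_map (top_of_set {l..u}) X H \<Longrightarrow> H ` {l..u} \<subseteq> U \<Longrightarrow>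
         c (line_simplex H (l::real) u) = \<beta> (H u) - \<beta> (H l)" by blast
    have "openin (top_of_set {0..1}) {s \<in> {0..1}. H s \<in> U}"
      using openin_continuous_map_preimage[OF H U(1)] by simp
    moreover have "x \<in> {s \<in> {0..1}. H s \<in> U}" using U(2) x by simp
    ultimately have "\<exists>d>0. \<forall>s\<in>{0..1}. dist s x < d \<longrightarrow> s \<in> {s \<in> {0..1}. H s \<in> U}"
      unfolding openin_euclidean_subtopology_iff by blast
    then obtain d where d: "d > 0" "\<And>s. s \<in> {0..1} \<Longrightarrow> dist s x < d \<Longrightarrow> H s \<in> U"
      by blast
    have "Q a b" if ab: "a \<le> x \<and> x \<le> b \<and> b - a < d" for a b
      unfolding Q_def
    proof (intro impI cU)
      assume *: "0 \<le> a" "b \<le> 1" "a \<le> b"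
      then have "{a..b} \<subseteq> {0..1}" by auto
      then show "continuous_map (top_of_set {a..b}) X H"
        using continuous_map_from_subtopology_mono[OF H] by blast
      show "H ` {a..b} \<subseteq> U"
        using * ab by (auto intro!: d(2) simp: dist_real_def)
    qed
    then show "\<exists>d>0. \<forall>a b. a \<le> x \<and> x \<le> b \<and> b - a < d \<longrightarrow> Q a b"
      using d(1) by blast
  qed simp
  then show ?thesis by (simp add: Q_def)
qed

section \<open>Integer cocycles from circle-valued maps\<close>

text \<open>A convex set is contractible, so \<open>h\<close> has a continuous logarithm, which is
purely imaginary because \<open>h\<close> has modulus one.\<close>

lemma circle_lift_exists:
  fixes h :: "'v::real_normed_vector \<Rightarrow> complex"
  assumes "continuous_on S h" "convex S" "\<And>z. z \<in> S \<Longrightarrow> norm (h z) = 1"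
  obtains g where "continuous_on S g" "\<And>z. z \<in> S \<Longrightarrow> h z = cis (2 * pi * g z)"
proof -
  have "h z \<noteq> 0" if "z \<in> S" for z
    using assms(3)[OF that] by auto
  then obtain l where l: "continuous_on S l" "\<And>z. z \<in> S \<Longrightarrow> h z = exp (l z)"
    using continuous_logarithm_on_contractible[OF assms(1) convex_imp_contractible[OF assms(2)]] by blast
  show ?thesis
  proof
    show "continuous_on S (\<lambda>z. Im (l z) / (2 * pi))"
      using l(1) by (intro continuous_intros) auto
    fix z assume z: "z \<in> S"
    have "exp (Re (l z)) = 1" using assms(3)[OF z] l(2)[OF z] by simp
    then have "Re (l z) = 0" by simp
    then show "h z = cis (2 * pi * (Im (l z) / (2 * pi)))"
      using l(2)[OF z] by (simp add: exp_eq_polar)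
  qed
qed

lemma cis_eq_imp_diff_Ints:
  assumes "cis (2 * pi * x) = cis (2 * pi * y)"
  shows "x - y \<in> \<int>"
proof -
  have "cis (2 * pi * (x - y)) = cis (2 * pi * x) / cis (2 * pi * y)"
    by (simp add: cis_divide right_diff_distrib)
  also have "\<dots> = 1" using assms by simp
  finally have "cos (2 * pi * (x - y)) = 1" by (simp add: complex_eq_iff)
  then obtain n :: int where "2 * pi * (x - y) = of_int n * 2 * pi"
    unfolding cos_one_2pi_int ..
  then have "x - y = of_int n" by simp
  then show ?thesis by simp
qed

text \<open>The difference of two lifts is continuous and integer valued, hence constant.\<close>

lemma circle_lift_unique:
  fixes g g' :: "'v::real_normed_vector \<Rightarrow> real"
  assumes "convex S" "continuous_on S g" "continuous_on S g'"
    and eq: "\<And>z. z \<in> S \<Longrightarrow> cis (2 * pi * g z) = cis (2 * pi * g' z)"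
    and "a \<in> S" "b \<in> S"
  shows "g b - g a = g' b - g' a"
proof -
  let ?d = "\<lambda>z. g z - g' z"
  have int: "?d z \<in> \<int>" if "z \<in> S" for z
    using cis_eq_imp_diff_Ints[OF eq[OF that]] .
  \<comment> \<open>Distinct integer values are at distance at least one.\<close>
  have "?d constant_on S"
  proof (rule continuous_discrete_range_constant)
    show "connected S" using assms(1) by (rule convex_connected)
    show "continuous_on S ?d" using assms(2,3) by (intro continuous_intros)
    fix x assume x: "x \<in> S"
    have "1 \<le> norm (?d y - ?d x)" if "y \<in> S" "?d y \<noteq> ?d x" for y
    proof -
      have "?d y - ?d x \<in> \<int>" using int x that(1) by (simp add: Ints_diff)
      then show ?thesis using that(2) Ints_nonzero_abs_ge1 by fastforce
    qed
    then show "\<exists>e>0. \<forall>y. y \<in> S \<and> ?d y \<noteq> ?d x \<longrightarrow> e \<le> norm (?d y - ?d x)"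
      using zero_less_one by blast
  qed
  then have "?d a = ?d b" using assms(5,6) unfolding constant_on_def by metis
  then show ?thesis by simp
qed

lemma line_simplex_01_inject:
  fixes H H' :: "real \<Rightarrow> 'x"
  assumes "line_simplex H 0 1 = line_simplex H' 0 1" "s \<in> {0..1}"
  shows "H s = H' s"
proof -
  let ?x = "\<lambda>i::nat. if i = 0 then 1 - s else if i = 1 then s else 0"
  have "?x \<in> standard_simplex 1" using assms(2) by (auto simp: standard_simplex_def)
  then have "line_simplex K 0 1 ?x = K s" for K :: "real \<Rightarrow> 'x"
    by (simp add: line_simplex_def)
  from this[of H] this[of H'] show ?thesis using assms(1) by simp
qed

text \<open>The pullback along \<open>F\<close> of a cocycle generating the first cohomology of
the circle. To a path it assigns the increment of a lift of the angle, measured in full turns,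
made integral by subtracting the increment of the discontinuous angle \<open>Arg\<close> at the
two end points. This correction is a real coboundary and so does not disturb the cocycle
condition.\<close>

definition circle_cochain :: "('x \<Rightarrow> complex) \<Rightarrow> ((nat \<Rightarrow> real) \<Rightarrow> 'x) \<Rightarrow> int" where
  "circle_cochain F \<sigma> = (THE n. \<exists>H g. \<sigma> = line_simplex H (0::real) 1 \<and> continuous_on {0..1} g \<and>
     (\<forall>s\<in>{0..1}. F (H s) = cis (2 * pi * g s)) \<and>
     of_int n = (g 1 - g 0) - (Arg (F (H 1)) - Arg (F (H 0))) / (2 * pi))"

text \<open>A lift \<open>g\<close> may be taken on any convex set that contains the segment, in
particular on a whole triangle at once.\<close>

lemma circle_cochain_line:
  fixes g :: "'v::real_normed_vector \<Rightarrow> real"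
  assumes S: "convex S" and g: "continuous_on S g" "\<And>z. z \<in> S \<Longrightarrow> F (H z) = cis (2 * pi * g z)"
    and ab: "a \<in> S" "b \<in> S"
  shows "of_int (circle_cochain F (line_simplex H a b)) =
    (g b - g a) - (Arg (F (H b)) - Arg (F (H a))) / (2 * pi)"
proof -
  let ?p = "\<lambda>s. (1 - s) *\<^sub>R a + s *\<^sub>R b"
  let ?r = "(g b - g a) - (Arg (F (H b)) - Arg (F (H a))) / (2 * pi)"
  let ?A = "\<lambda>n::int. \<exists>H' g'. line_simplex H a b = line_simplex H' (0::real) 1 \<and> continuous_on {0..1} g' \<and>
     (\<forall>s\<in>{0..1}. F (H' s) = cis (2 * pi * g' s)) \<and>
     of_int n = (g' 1 - g' 0) - (Arg (F (H' 1)) - Arg (F (H' 0))) / (2 * pi)"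
  have p: "?p s \<in> S" if "s \<in> {0..1}" for s
    using S ab that by (auto intro: convexD_alt)
  have line: "line_simplex H a b = line_simplex (\<lambda>s. H (?p s)) (0::real) 1"
    by (rule line_simplex_eqI) simp
  have gp: "continuous_on {0..1} (\<lambda>s. g (?p s))"
    using p by (intro continuous_on_compose2[OF g(1)] continuous_intros) auto
  have "g z - Arg (F (H z)) / (2 * pi) \<in> \<int>" if "z \<in> S" for z
  proof (rule cis_eq_imp_diff_Ints)
    have "F (H z) \<noteq> 0" "norm (F (H z)) = 1" using g(2)[OF that] by auto
    then have "cis (Arg (F (H z))) = F (H z)"
      by (simp add: cis_Arg sgn_div_norm)
    then show "cis (2 * pi * g z) = cis (2 * pi * (Arg (F (H z)) / (2 * pi)))"
      using g(2)[OF that] by simp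
  qed
  from Ints_diff[OF this[OF ab(2)] this[OF ab(1)]] obtain n :: int where n: "?r = of_int n"
    by (auto simp: algebra_simps diff_divide_distrib elim: Ints_cases)
  have "?A n"
    using line gp g(2)[OF p] n
    by (intro exI[of _ "\<lambda>s. H (?p s)"] exI[of _ "\<lambda>s. g (?p s)"] conjI ballI) simp_all
  moreover have "m = n" if m: "?A m" for m
  proof -
    obtain H' g' where *: "line_simplex H a b = line_simplex H' (0::real) 1" "continuous_on {0..1} g'"
      "\<And>s. s\<in>{0..1} \<Longrightarrow> F (H' s) = cis (2 * pi * g' s)"
      "of_int m = (g' 1 - g' 0) - (Arg (F (H' 1)) - Arg (F (H' 0))) / (2 * pi)"
      using m by blast
    \<comment> \<open>The simplex determines the path, so any other witness differs only in its lift.\<close>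
    have H': "H' s = H (?p s)" if "s \<in> {0..1}" for s
      using line_simplex_01_inject[of H' "\<lambda>s. H (?p s)" s] that *(1) line by simp
    have "g' 1 - g' 0 = g (?p 1) - g (?p 0)"
    proof (rule circle_lift_unique[OF convex_real_interval(5) *(2) gp])
      fix s :: real assume s: "s \<in> {0..1}"
      show "cis (2 * pi * g' s) = cis (2 * pi * g (?p s))"
        using *(3)[OF s] H'[OF s] g(2)[OF p[OF s]] by simp
    qed auto
    then have "of_int m = ?r" using *(4) H'[of 0] H'[of 1] by simp
    then show "m = n" using n by simp
  qed
  ultimately have "circle_cochain F (line_simplex H a b) = n"
    unfolding circle_cochain_def by (intro the_equality) blast+
  then show ?thesis using n by simp
qed

text \<open>A lift over the whole \<open>2\<close>-simplex computes the values on all three edges,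
and the increments of a function around a triangle cancel.\<close>

lemma singular_1_cocycle_circle_cochain:
  fixes F :: "'x \<Rightarrow> complex"
  assumes F: "continuous_map X euclidean F" and norm: "\<And>y. y \<in> topspace X \<Longrightarrow> norm (F y) = 1"
  shows "singular_1_cocycle X (circle_cochain F)"
  unfolding singular_1_cocycle_def
proof (intro allI impI)
  fix \<tau> assume "singular_simplex 2 X \<tau>"
  then obtain H where H: "continuous_map (top_of_set {z. 0 \<le> fst z \<and> 0 \<le> snd z \<and> fst z + snd z \<le> 1}) X H"
    and \<tau>: "\<tau> = triangle_simplex H (0,0) (1::real,0::real) (0,1)"
    by (rule singular_2_simplex_as_triangle)
  let ?T = "{z. 0 \<le> fst z \<and> 0 \<le> snd z \<and> fst z + snd z \<le> (1::real)}"
  have "continuous_on ?T (F \<circ> H)"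
    using continuous_map_compose[OF H F] by simp
  moreover have "norm ((F \<circ> H) z) = 1" if "z \<in> ?T" for z
    using norm continuous_map_funspace[OF H] that by auto
  ultimately obtain g where g: "continuous_on ?T g" "\<And>z. z \<in> ?T \<Longrightarrow> (F \<circ> H) z = cis (2 * pi * g z)"
    using circle_lift_exists[OF _ convex_triangle] by blast
  have *: "of_int (circle_cochain F (line_simplex H a b)) =
    (g b - g a) - (Arg (F (H b)) - Arg (F (H a))) / (2 * pi)" if "a \<in> ?T" "b \<in> ?T" for a b
    by (rule circle_cochain_line[where F = F and H = H and g = g, OF convex_triangle])
      (use g that in \<open>simp_all only: comp_apply\<close>)
  have "real_of_int (circle_cochain F (line_simplex H (1,0) (0,1)) + circle_cochain F (line_simplex H (0,0) (1,0))) =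
     real_of_int (circle_cochain F (line_simplex H (0,0) (0,1)))"
    unfolding of_int_add by (subst (1 2 3) *) (auto simp: diff_divide_distrib)
  then show "circle_cochain F (singular_face 2 0 \<tau>) + circle_cochain F (singular_face 2 2 \<tau>) =
      circle_cochain F (singular_face 2 1 \<tau>)"
    unfolding \<tau> faces_of_triangle of_int_eq_iff .
qed

section \<open>Low-dimensional simplices and coboundaries\<close>

lemma order_face_in_order_simplices:
  assumes "\<sigma> \<in> order_simplices P (Suc n)" "k \<le> Suc n"
  shows "order_face k \<sigma> \<in> order_simplices P n"
proof -
  have k: "k < length \<sigma>" using assms by (simp add: order_simplices_def)
  have "sorted_wrt (<) (take k \<sigma> @ \<sigma> ! k # drop (Suc k) \<sigma>)"
    using assms(1) id_take_nth_drop[OF k] by (simp add: order_simplices_def)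
  moreover have "set (order_face k \<sigma>) \<subseteq> set \<sigma>"
    unfolding order_face_def using set_take_subset set_drop_subset by fastforce
  ultimately show ?thesis
    using assms k by (auto simp: order_simplices_def order_face_def sorted_wrt_append)
qed

lemma nth_order_face:
  assumes "k < length \<sigma>"
  shows "order_face k \<sigma> ! i = \<sigma> ! (if i < k then i else Suc i)"
  using assms by (auto simp: order_face_def nth_append)

lemma order_simplices_01:
  "[v] \<in> order_simplices P 0 \<longleftrightarrow> v \<in> P"
  "[v, w] \<in> order_simplices P 1 \<longleftrightarrow> v \<in> P \<and> w \<in> P \<and> v < w"
  by (auto simp: order_simplices_def)

lemma order_simplices_2:
  "[u, v, w] \<in> order_simplices P 2 \<longleftrightarrow> u \<in> P \<and> v \<in> P \<and> w \<in> P \<and> u < v \<and> v < w"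
  by (auto simp: order_simplices_def numeral_2_eq_2)


lemma order_simplices_1E:
  assumes "\<sigma> \<in> order_simplices P 1" obtains v w where "\<sigma> = [v, w]" "v \<in> P" "w \<in> P" "v < w"
  using assms by (auto simp: order_simplices_def length_Suc_conv)

lemma order_simplices_2E:
  assumes "\<sigma> \<in> order_simplices P 2"
  obtains u v w where "\<sigma> = [u, v, w]" "u \<in> P" "v \<in> P" "w \<in> P" "u < v" "v < w"
  using assms by (auto simp: order_simplices_def length_Suc_conv numeral_2_eq_2)

lemma order_coboundary_edge:
  assumes "v \<in> P" "w \<in> P" "v < w"
  shows "order_coboundary P 0 f [v, w] = f [w] - f [v]"
  using assms order_simplices_01(2)[of v w P] by (simp add: order_coboundary_def order_face_def)

lemma order_coboundary_triangle:
  assumes "u \<in> P" "v \<in> P" "w \<in> P" "u < v" "v < w"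
  shows "order_coboundary P 1 f [u, v, w] = f [v, w] - f [u, w] + f [u, v]"
  using assms order_simplices_2[of u v w P] by (simp add: order_coboundary_def order_face_def numeral_2_eq_2)

lemma group_hom_order_coboundary:
  "group_hom (integer_functions (order_simplices P n)) (integer_functions (order_simplices P (Suc n)))
     (order_coboundary P n)"
proof -
  have "order_coboundary P n \<in> hom (integer_functions (order_simplices P n)) (integer_functions (order_simplices P (Suc n)))"
    unfolding order_coboundary_def[abs_def]
    by (rule hom_alternating_sum) (simp add: order_face_in_order_simplices)
  then show ?thesis
    by (simp add: group_hom_def group_hom_axioms_def)
qed

lemma group_hom_singular_coboundary:
  "group_hom (singular_cochain_group X n) (singular_cochain_group X (Suc n)) (singular_coboundary X n)"
proof -
  have "singular_coboundary X n \<in> hom (singular_cochain_group X n) (singular_cochain_group X (Suc n))"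
    unfolding singular_coboundary_def[abs_def] singular_cochain_group_def
    by (rule hom_alternating_sum) (use singular_simplex_singular_face[of "Suc n" X] in auto)
  then show ?thesis
    by (simp add: group_hom_def group_hom_axioms_def singular_cochain_group_def)
qed

lemma singular_1_cocycle_iff:
  assumes "c \<in> singular_simplex_set 1 X \<rightarrow>\<^sub>E UNIV"
  shows "singular_coboundary X 1 c = \<one>\<^bsub>singular_cochain_group X 2\<^esub> \<longleftrightarrow> singular_1_cocycle X c"
proof -
  have "singular_coboundary X 1 c = \<one>\<^bsub>singular_cochain_group X 2\<^esub> \<longleftrightarrow>
    (\<forall>\<tau>. singular_simplex 2 X \<tau> \<longrightarrow> c (singular_face 2 0 \<tau>) - c (singular_face 2 1 \<tau>) + c (singular_face 2 2 \<tau>) = 0)"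
    unfolding singular_cochain_group_def integer_functions_simps singular_coboundary_def
    by (auto simp: fun_eq_iff restrict_def numeral_2_eq_2)
  then show ?thesis
    unfolding singular_1_cocycle_def by (simp add: algebra_simps)
qed

lemma singular_1_cocycle_coboundary: "singular_1_cocycle X (singular_coboundary X 0 b)"
  unfolding singular_1_cocycle_def
proof (intro allI impI)
  fix \<tau> assume "singular_simplex 2 X \<tau>"
  then obtain H where H: "continuous_map (top_of_set {z. 0 \<le> fst z \<and> 0 \<le> snd z \<and> fst z + snd z \<le> 1}) X H"
    and \<tau>: "\<tau> = triangle_simplex H (0,0) (1::real,0::real) (0,1)"
    by (rule singular_2_simplex_as_triangle)
  note line = singular_coboundary_line[OF H convex_triangle, of _ _ b]
  show "singular_coboundary X 0 b (singular_face 2 0 \<tau>) + singular_coboundary X 0 b (singular_face 2 2 \<tau>) =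
      singular_coboundary X 0 b (singular_face 2 1 \<tau>)"
    unfolding \<tau> faces_of_triangle by (subst (1 2 3) line) auto
qed

section \<open>The orbit space of a finite poset with a group action\<close>

locale finite_poset_action = group G for G (structure) +
  fixes P :: "'v::order set" and \<phi> :: "'a \<Rightarrow> 'v \<Rightarrow> 'v"
  assumes finite_P: "finite P"
    and act_closed [simp]: "\<And>g v. g \<in> carrier G \<Longrightarrow> v \<in> P \<Longrightarrow> \<phi> g v \<in> P"
    and act_one [simp]: "\<And>v. v \<in> P \<Longrightarrow> \<phi> \<one> v = v"
    and act_mult: "\<And>g h v. g \<in> carrier G \<Longrightarrow> h \<in> carrier G \<Longrightarrow> v \<in> P \<Longrightarrow> \<phi> (g \<otimes> h) v = \<phi> g (\<phi> h v)"
    and act_mono: "\<And>g v w. g \<in> carrier G \<Longrightarrow> v \<in> P \<Longrightarrow> w \<in> P \<Longrightarrow> v \<le> w \<Longrightarrow> \<phi> g v \<le> \<phi> g w"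
begin

abbreviation K where "K \<equiv> order_realization P"
abbreviation A where "A \<equiv> realization_action G \<phi> P"
abbreviation q where "q \<equiv> orbit G A"
abbreviation X where "X \<equiv> orbit_space G A K"

lemma act_inv [simp]:
  assumes "g \<in> carrier G" "v \<in> P"
  shows "\<phi> (inv g) (\<phi> g v) = v" "\<phi> g (\<phi> (inv g) v) = v"
  using assms act_mult[of "inv g" g v] act_mult[of g "inv g" v] by auto

lemma act_inj: "g \<in> carrier G \<Longrightarrow> v \<in> P \<Longrightarrow> w \<in> P \<Longrightarrow> \<phi> g v = \<phi> g w \<longleftrightarrow> v = w"
  by (metis act_inv(1))

lemma bij_betw_act: "g \<in> carrier G \<Longrightarrow> bij_betw (\<phi> g) P P"
  by (rule bij_betw_byWitness[where f' = "\<phi> (inv g)"]) auto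

lemma act_le_iff: "g \<in> carrier G \<Longrightarrow> v \<in> P \<Longrightarrow> w \<in> P \<Longrightarrow> \<phi> g v \<le> \<phi> g w \<longleftrightarrow> v \<le> w"
  using act_mono[of "inv g" "\<phi> g v" "\<phi> g w"] act_mono[of g v w] by auto

lemma act_less_iff: "g \<in> carrier G \<Longrightarrow> v \<in> P \<Longrightarrow> w \<in> P \<Longrightarrow> \<phi> g v < \<phi> g w \<longleftrightarrow> v < w"
  by (simp add: less_le act_le_iff act_inj)

text \<open>If \<open>v \<le> \<phi> g v\<close>, the lower set of \<open>v\<close> is contained
in that of \<open>\<phi> g v\<close>; they have the same finite cardinality since \<open>\<phi>
g\<close> carries one onto the other, so they are equal.\<close>

lemma orbit_antichain_aux:
  assumes "g \<in> carrier G" "v \<in> P" "v \<le> \<phi> g v"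
  shows "\<phi> g v = v"
proof -
  let ?D = "\<lambda>w. {u \<in> P. u \<le> w}"
  have "\<phi> g ` ?D v = ?D (\<phi> g v)"
  proof (intro equalityI subsetI)
    fix u assume "u \<in> ?D (\<phi> g v)"
    then have "u = \<phi> g (\<phi> (inv g) u)" "\<phi> (inv g) u \<in> ?D v"
      using assms act_mono[of "inv g" u "\<phi> g v"] by auto
    then show "u \<in> \<phi> g ` ?D v" by blast
  qed (use assms act_mono in auto)
  moreover have "inj_on (\<phi> g) (?D v)" using assms by (auto simp: inj_on_def act_inj)
  ultimately have "card (?D (\<phi> g v)) = card (?D v)" by (metis card_image)
  moreover have "?D v \<subseteq> ?D (\<phi> g v)" using assms(3) by auto
  ultimately have "?D v = ?D (\<phi> g v)"
    using finite_P by (intro card_subset_eq) auto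
  then have "\<phi> g v \<le> v" using assms(1,2) by (simp add: set_eq_iff) (metis act_closed order_refl)
  then show ?thesis using assms(3) by simp
qed

text \<open>Consequently a chain meets every orbit at most once. It follows that a group element
that maps one point of an open star to another point of the same star fixes the centre.\<close>

lemma orbit_antichain:
  assumes "g \<in> carrier G" "v \<in> P" "v \<le> \<phi> g v \<or> \<phi> g v \<le> v"
  shows "\<phi> g v = v"
  using assms(3)
proof
  assume "\<phi> g v \<le> v"
  then have "\<phi> (inv g) (\<phi> g v) = \<phi> g v"
    using assms by (intro orbit_antichain_aux) auto
  then show ?thesis using assms by simp
qed (use assms orbit_antichain_aux in auto)

lemma topspace_K_iff:
  "t \<in> topspace K \<longleftrightarrow> t \<in> extensional P \<and> (\<forall>v\<in>P. 0 \<le> t v) \<and>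
     (\<forall>v\<in>P. \<forall>w\<in>P. t v \<noteq> 0 \<and> t w \<noteq> 0 \<longrightarrow> v \<le> w \<or> w \<le> v) \<and> (\<Sum>v\<in>P. t v) = 1"
proof -
  have "(\<Sum>v | v \<in> P \<and> t v \<noteq> 0. t v) = (\<Sum>v\<in>P. t v)"
    using finite_P by (intro sum.mono_neutral_left) auto
  then show ?thesis
    using finite_P by (auto simp: order_realization_def PiE_def)
qed

lemma topspace_KD:
  assumes "t \<in> topspace K"
  shows "t \<in> extensional P" "\<And>v. v \<in> P \<Longrightarrow> 0 \<le> t v" "(\<Sum>v\<in>P. t v) = 1"
    "\<And>v w. v \<in> P \<Longrightarrow> w \<in> P \<Longrightarrow> t v \<noteq> 0 \<Longrightarrow> t w \<noteq> 0 \<Longrightarrow> v \<le> w \<or> w \<le> v"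
  using assms unfolding topspace_K_iff by blast+

lemma support_nonempty:
  assumes "t \<in> topspace K" obtains v where "v \<in> P" "t v \<noteq> 0"
  using topspace_KD(3)[OF assms] by (metis sum.neutral zero_neq_one)

lemma continuous_map_coordinate:
  assumes "v \<in> P" shows "continuous_map K euclideanreal (\<lambda>t. t v)"
  unfolding order_realization_def
  by (intro continuous_map_from_subtopology continuous_map_product_projection assms)

text \<open>Coordinatewise continuity suffices because \<open>K\<close> carries the topology of
coordinatewise convergence.\<close>

lemma continuous_map_into_K:
  assumes "\<And>z. z \<in> topspace Z \<Longrightarrow> f z \<in> topspace K"
    and "\<And>v. v \<in> P \<Longrightarrow> continuous_map Z euclideanreal (\<lambda>z. f z v)"
  shows "continuous_map Z K f"
proof -
  have "continuous_map Z (powertop_real P) f"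
    unfolding continuous_map_componentwise using assms topspace_KD(1) by auto
  then show ?thesis
    using assms(1) by (simp add: order_realization_def continuous_map_in_subtopology Pi_iff)
qed

lemma A_apply: "v \<in> P \<Longrightarrow> A g t v = t (\<phi> (inv g) v)"
  by (simp add: realization_action_def)

lemma A_act [simp]: "g \<in> carrier G \<Longrightarrow> v \<in> P \<Longrightarrow> A g t (\<phi> g v) = t v"
  by (simp add: A_apply)

lemma A_extensional [simp]: "A g t \<in> extensional P"
  by (simp add: realization_action_def)

lemma A_one: "t \<in> extensional P \<Longrightarrow> A \<one> t = t"
  by (intro extensionalityI[of _ P]) (simp_all add: A_apply)

lemma A_mult: "g \<in> carrier G \<Longrightarrow> h \<in> carrier G \<Longrightarrow> A g (A h t) = A (g \<otimes> h) t"
  by (intro extensionalityI[of _ P]) (simp_all add: A_apply inv_mult_group act_mult)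


lemma A_in_K [simp]:
  assumes g: "g \<in> carrier G" and t: "t \<in> topspace K"
  shows "A g t \<in> topspace K"
  unfolding topspace_K_iff
proof (intro conjI ballI impI)
  have "(\<Sum>v\<in>P. A g t v) = (\<Sum>v\<in>P. t (\<phi> (inv g) v))" by (simp add: A_apply)
  also have "\<dots> = (\<Sum>v\<in>P. t v)"
    using g by (intro sum.reindex_bij_betw bij_betw_act) auto
  finally show "(\<Sum>v\<in>P. A g t v) = 1" using topspace_KD(3)[OF t] by simp
  fix v w assume *: "v \<in> P" "w \<in> P" "A g t v \<noteq> 0 \<and> A g t w \<noteq> 0"
  then have "\<phi> (inv g) v \<le> \<phi> (inv g) w \<or> \<phi> (inv g) w \<le> \<phi> (inv g) v"
    using g by (intro topspace_KD(4)[OF t]) (auto simp: A_apply)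
  then show "v \<le> w \<or> w \<le> v" using * g by (simp add: act_le_iff)
qed (use g topspace_KD(2)[OF t] in \<open>auto simp: A_apply\<close>)

lemma continuous_map_A:
  assumes "g \<in> carrier G" shows "continuous_map K K (A g)"
proof (rule continuous_map_into_K)
  fix v assume v: "v \<in> P"
  then have "continuous_map K euclideanreal (\<lambda>t. t (\<phi> (inv g) v))"
    using assms by (intro continuous_map_coordinate) auto
  then show "continuous_map K euclideanreal (\<lambda>t. A g t v)"
    using v by (simp add: A_apply)
qed (use assms in auto)

lemma q_A [simp]:
  assumes "g \<in> carrier G" shows "q (A g t) = q t"
proof (intro equalityI subsetI)
  fix y assume "y \<in> q (A g t)"
  then obtain h where "h \<in> carrier G" "y = A h (A g t)" by (auto simp: orbit_def)
  then show "y \<in> q t" using assms A_mult unfolding orbit_def by blast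
next
  fix y assume "y \<in> q t"
  then obtain h where h: "h \<in> carrier G" "y = A h t" by (auto simp: orbit_def)
  then have "y = A (h \<otimes> inv g) (A g t)" using assms by (simp add: A_mult m_assoc)
  then show "y \<in> q (A g t)" using assms h(1) unfolding orbit_def by blast
qed

lemma q_eqD:
  assumes "q t = q t'" "t \<in> topspace K"
  obtains g where "g \<in> carrier G" "t = A g t'"
proof -
  have "t = A \<one> t" using topspace_KD(1)[OF assms(2)] by (simp add: A_one)
  then have "t \<in> q t" unfolding orbit_def by blast
  then show ?thesis using that unfolding assms(1) by (auto simp: orbit_def)
qed

lemma q_in_X [simp]: "t \<in> topspace K \<Longrightarrow> q t \<in> topspace X"
  by (auto simp: topspace_orbit_space orbits_def)

lemma X_cases:
  assumes "y \<in> topspace X" obtains t where "t \<in> topspace K" "y = q t"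
  using assms by (auto simp: topspace_orbit_space orbits_def)

lemma continuous_map_q: "continuous_map K X q"
  by (rule quotient_imp_continuous_map[OF quotient_map_orbit])

text \<open>The preimage of \<open>q ` U\<close> is the union of the translates of
\<open>U\<close>.\<close>

lemma open_map_q: "open_map K X q"
  unfolding open_map_def
proof (intro allI impI)
  fix U assume U: "openin K U"
  then have sub: "U \<subseteq> topspace K" by (rule openin_subset)
  have "{t \<in> topspace K. q t \<in> q ` U} = (\<Union>g\<in>carrier G. {t \<in> topspace K. A g t \<in> U})"
  proof (intro equalityI subsetI)
    fix t assume "t \<in> {t \<in> topspace K. q t \<in> q ` U}"
    then obtain u where u: "t \<in> topspace K" "u \<in> U" "q u = q t" by auto
    with sub obtain g where "g \<in> carrier G" "u = A g t" using q_eqD by blast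
    then show "t \<in> (\<Union>g\<in>carrier G. {t \<in> topspace K. A g t \<in> U})" using u by auto
  next
    fix t assume "t \<in> (\<Union>g\<in>carrier G. {t \<in> topspace K. A g t \<in> U})"
    then obtain g where g: "t \<in> topspace K" "g \<in> carrier G" "A g t \<in> U" by auto
    then have "q t = q (A g t)" by simp
    then show "t \<in> {t \<in> topspace K. q t \<in> q ` U}" using g by blast
  qed
  moreover have "openin K (\<Union>g\<in>carrier G. {t \<in> topspace K. A g t \<in> U})"
    using openin_continuous_map_preimage[OF continuous_map_A U] by (intro openin_Union) auto
  ultimately show "openin X (q ` U)"
    using sub by (auto simp: openin_orbit_space orbits_def)
qed

definition vertex :: "'v \<Rightarrow> 'v \<Rightarrow> real" where
  "vertex v = (\<lambda>w\<in>P. if w = v then 1 else 0)"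

definition segment :: "('v \<Rightarrow> real) \<Rightarrow> ('v \<Rightarrow> real) \<Rightarrow> real \<Rightarrow> 'v \<Rightarrow> real" where
  "segment t t' s = (\<lambda>w\<in>P. (1 - s) * t w + s * t' w)"

text \<open>The open star of the vertex \<open>v\<close> in the order complex.\<close>

definition star :: "'v \<Rightarrow> ('v \<Rightarrow> real) set" where
  "star v = {t \<in> topspace K. t v \<noteq> 0}"

lemma openin_star: "v \<in> P \<Longrightarrow> openin K (star v)"
  using openin_continuous_map_preimage[OF continuous_map_coordinate, of v "- {0}"]
  by (simp add: star_def open_Compl)

lemma vertex_in_K [simp]: "v \<in> P \<Longrightarrow> vertex v \<in> topspace K"
  using finite_P by (auto simp: topspace_K_iff vertex_def)

lemma vertex_in_star [simp]: "v \<in> P \<Longrightarrow> vertex v \<in> star v"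
  using vertex_in_K[of v] by (simp add: star_def) (simp add: vertex_def)

lemma A_vertex: "g \<in> carrier G \<Longrightarrow> v \<in> P \<Longrightarrow> A g (vertex v) = vertex (\<phi> g v)"
  by (intro extensionalityI[of _ P]) (auto simp: A_apply vertex_def)

lemma A_segment: "g \<in> carrier G \<Longrightarrow> A g (segment t t' s) = segment (A g t) (A g t') s"
  by (intro extensionalityI[of _ P]) (auto simp: A_apply segment_def)

lemma segment_same: "t \<in> topspace K \<Longrightarrow> segment t t s = t"
  using topspace_KD(1)[of t]
  by (intro extensionalityI[of _ P]) (auto simp: segment_def algebra_simps)

lemma segment_0: "t \<in> topspace K \<Longrightarrow> segment t t' 0 = t"
  and segment_1: "t' \<in> topspace K \<Longrightarrow> segment t t' 1 = t'"
  using topspace_KD(1)[of t] topspace_KD(1)[of t']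
  by (auto intro!: extensionalityI[of _ P] simp: segment_def)

text \<open>Points of the (possibly degenerate) triangle with corners \<open>v\<close>,
\<open>u\<close> and \<open>t\<close> stay in the closed simplex that carries
\<open>t\<close>.\<close>

lemma three_vertices_in_K:
  assumes t: "t \<in> topspace K" and v: "v \<in> P" "t v \<noteq> 0" and u: "u \<in> P" "t u \<noteq> 0"
    and "0 \<le> a" "0 \<le> b" "0 \<le> d" "a + b + d = 1"
  shows "(\<lambda>w\<in>P. a * vertex v w + b * vertex u w + d * t w) \<in> topspace K" (is "?m \<in> _")
  unfolding topspace_K_iff
proof (intro conjI ballI impI)
  have "(\<Sum>w\<in>P. ?m w) = a * (\<Sum>w\<in>P. vertex v w) + b * (\<Sum>w\<in>P. vertex u w) + d * (\<Sum>w\<in>P. t w)"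
    by (simp add: sum.distrib sum_distrib_left)
  then show "(\<Sum>w\<in>P. ?m w) = 1"
    using assms topspace_KD(3)[OF t] topspace_KD(3)[OF vertex_in_K] by simp
  fix x y assume *: "x \<in> P" "y \<in> P" "?m x \<noteq> 0 \<and> ?m y \<noteq> 0"
  then have "t x \<noteq> 0" "t y \<noteq> 0" using v u by (auto simp: vertex_def split: if_splits)
  then show "x \<le> y \<or> y \<le> x" using topspace_KD(4)[OF t] * by blast
qed (use assms topspace_KD(2)[OF t] in \<open>auto simp: vertex_def\<close>)

lemma segment_in_K:
  assumes "t \<in> star v" "v \<in> P" "0 \<le> s" "s \<le> 1"
  shows "segment (vertex v) t s \<in> topspace K"
  using three_vertices_in_K[of t v v 0 "1 - s" s] assms by (simp add: star_def segment_def)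

text \<open>The straight path from the vertex \<open>v\<close> to the point \<open>t\<close>, seen
in the orbit space.\<close>

definition spoke :: "'v \<Rightarrow> ('v \<Rightarrow> real) \<Rightarrow> (nat \<Rightarrow> real) \<Rightarrow> ('v \<Rightarrow> real) set" where
  "spoke v t = line_simplex (\<lambda>s. q (segment (vertex v) t s)) (0::real) 1"

lemma spoke_A: "g \<in> carrier G \<Longrightarrow> v \<in> P \<Longrightarrow> spoke (\<phi> g v) (A g t) = spoke v t"
  unfolding spoke_def by (simp add: A_vertex[symmetric] A_segment[symmetric])

text \<open>The cocycle condition on the triangle with corners \<open>v\<close>, \<open>u\<close>,
\<open>t\<close>.\<close>

lemma spoke_add:
  assumes c: "singular_1_cocycle X c"
    and t: "t \<in> star v" "t \<in> star u" and vu: "v \<in> P" "u \<in> P"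
  shows "c (spoke v t) = c (spoke v (vertex u)) + c (spoke u t)"
proof -
  let ?T = "{z. 0 \<le> fst z \<and> 0 \<le> snd z \<and> fst z + snd z \<le> (1::real)}"
  let ?H = "\<lambda>z. (\<lambda>w\<in>P. (1 - fst z - snd z) * vertex v w + fst z * vertex u w + snd z * t w)"
  have "continuous_map (top_of_set ?T) K ?H"
  proof (rule continuous_map_into_K)
    show "?H z \<in> topspace K" if "z \<in> topspace (top_of_set ?T)" for z
      using that t vu by (intro three_vertices_in_K) (auto simp: star_def)
    show "continuous_map (top_of_set ?T) euclideanreal (\<lambda>z. ?H z w)" if "w \<in> P" for w
      using that by (auto intro!: continuous_intros)
  qed
  then have "continuous_map (top_of_set ?T) X (q \<circ> ?H)"
    by (rule continuous_map_compose[OF _ continuous_map_q])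
  from singular_1_cocycle_line_add[OF c this convex_triangle, of "(0,0)" "(1,0)" "(0,1)"]
  have "c (line_simplex (q \<circ> ?H) (0,0) (1,0)) + c (line_simplex (q \<circ> ?H) (1,0) (0,1)) =
      c (line_simplex (q \<circ> ?H) (0,0) (0,1))" by simp
  moreover have "line_simplex (q \<circ> ?H) (0,0) (1,0) = spoke v (vertex u)"
    "line_simplex (q \<circ> ?H) (1,0) (0,1) = spoke u t" "line_simplex (q \<circ> ?H) (0,0) (0,1) = spoke v t"
    unfolding spoke_def segment_def
    by (rule line_simplex_eqI, simp add: algebra_simps)+
  ultimately show ?thesis by simp
qed

lemma spoke_vertex_same:
  assumes c: "singular_1_cocycle X c" and v: "v \<in> P"
  shows "c (spoke v (vertex v)) = 0"
  using spoke_add[OF c, of "vertex v" v v] v by simp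

lemma spoke_vertex_swap:
  assumes c: "singular_1_cocycle X c"
    and t: "t \<in> star v" "t \<in> star u" and vu: "v \<in> P" "u \<in> P"
  shows "c (spoke v (vertex u)) = - c (spoke u (vertex v))"
  using spoke_add[OF c t vu] spoke_add[OF c t(2,1) vu(2,1)] by simp

section \<open>Cocycles that are coboundaries on edges\<close>

text \<open>Both \<open>v\<close> and \<open>\<phi> g v\<close> lie in the support of
\<open>t\<close>, hence are comparable, hence equal.\<close>

lemma q_eq_on_starD:
  assumes "q t = q t'" "t \<in> star v" "t' \<in> star v" "v \<in> P"
  obtains g where "g \<in> carrier G" "t = A g t'" "\<phi> g v = v"
proof -
  obtain g where g: "g \<in> carrier G" "t = A g t'"
    using q_eqD[OF assms(1)] assms(2) by (auto simp: star_def)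
  have "t (\<phi> g v) \<noteq> 0" "t v \<noteq> 0" using g assms by (simp_all add: star_def)
  then have "v \<le> \<phi> g v \<or> \<phi> g v \<le> v"
    using assms g by (intro topspace_KD(4)[of t]) (auto simp: star_def)
  then show ?thesis using that g orbit_antichain assms(4) by blast
qed

text \<open>The contraction of the image of an open star to its centre. The choice of the
representative inside the star does not matter, since any two differ by an element that fixes
\<open>v\<close>.\<close>

definition cone :: "'v \<Rightarrow> real \<Rightarrow> ('v \<Rightarrow> real) set \<Rightarrow> ('v \<Rightarrow> real) set" where
  "cone v s y = q (segment (vertex v) (SOME t. t \<in> star v \<and> q t = y) s)"

lemma cone_q:
  assumes "t \<in> star v" "v \<in> P" shows "cone v s (q t) = q (segment (vertex v) t s)"
proof -
  define t' where "t' = (SOME t'. t' \<in> star v \<and> q t' = q t)"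
  have "t' \<in> star v \<and> q t' = q t" 
    unfolding t'_def using someI[of "\<lambda>t'. t' \<in> star v \<and> q t' = q t" t] assms by simp
  then obtain g where g: "g \<in> carrier G" "t' = A g t" "\<phi> g v = v"
    using q_eq_on_starD assms by blast
  then have "segment (vertex v) t' s = A g (segment (vertex v) t s)"
    using assms by (simp add: A_segment A_vertex)
  then show ?thesis unfolding cone_def t'_def[symmetric] using g(1) by simp
qed

text \<open>Upstairs the contraction is a polynomial in coordinates. It descends because
\<open>q\<close>, being open, restricts to a quotient map from the star to its image, and this
remains a quotient map after taking the product with the compact interval.\<close>

lemma continuous_map_cone:
  assumes v: "v \<in> P"
  shows "continuous_map (prod_topology (top_of_set {0..1}) (subtopology X (q ` star v))) X
    (\<lambda>(s, y). cone v s y)"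
proof -
  let ?I = "top_of_set {0..1::real}"
  have star: "star v \<subseteq> topspace K" by (auto simp: star_def)
  have quot: "quotient_map (subtopology K (star v)) (subtopology X (q ` star v)) q"
  proof (rule continuous_open_imp_quotient_map)
    show "continuous_map (subtopology K (star v)) (subtopology X (q ` star v)) q"
      using continuous_map_q star
      by (auto simp: continuous_map_in_subtopology continuous_map_from_subtopology)
    have "open_map (subtopology K (star v)) X q"
      using open_map_q openin_star[OF v] by (rule open_map_from_subtopology)
    then show "open_map (subtopology K (star v)) (subtopology X (q ` star v)) q"
      using star by (intro open_map_into_subtopology) auto
    show "q ` topspace (subtopology K (star v)) = topspace (subtopology X (q ` star v))"
      using star by (auto simp: image_iff)
  qed
  have "locally_compact_space ?I" "Hausdorff_space ?I"
    by (auto simp: compact_imp_locally_compact_space Hausdorff_space_subtopology compact_space_subtopology)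
  then have quot2: "quotient_map (prod_topology ?I (subtopology K (star v)))
     (prod_topology ?I (subtopology X (q ` star v))) (\<lambda>(s, t). (s, q t))"
    using quot by (intro quotient_map_prod_right) auto
  have "continuous_map (prod_topology ?I (subtopology K (star v))) K
     (\<lambda>(s, t). segment (vertex v) t s)"
  proof (rule continuous_map_into_K)
    fix z assume "z \<in> topspace (prod_topology ?I (subtopology K (star v)))"
    then show "(case z of (s, t) \<Rightarrow> segment (vertex v) t s) \<in> topspace K"
      using v by (auto intro: segment_in_K)
  next
    fix w assume w: "w \<in> P"
    have fst: "continuous_map (prod_topology ?I (subtopology K (star v))) euclideanreal fst"
      using continuous_map_into_fulltopology[OF continuous_map_fst] by blast
    have snd: "continuous_map (prod_topology ?I (subtopology K (star v))) euclideanreal (\<lambda>z. snd z w)"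
      using continuous_map_compose[OF continuous_map_snd continuous_map_from_subtopology[OF continuous_map_coordinate[OF w]]]
      by (simp add: o_def)
    show "continuous_map (prod_topology ?I (subtopology K (star v))) euclideanreal
       (\<lambda>z. (case z of (s, t) \<Rightarrow> segment (vertex v) t s) w)"
      using w by (simp add: case_prod_unfold segment_def) (intro continuous_intros fst snd)
  qed
  then have "continuous_map (prod_topology ?I (subtopology K (star v))) X
     (q \<circ> (\<lambda>(s, t). segment (vertex v) t s))"
    by (rule continuous_map_compose[OF _ continuous_map_q])
  then have "continuous_map (prod_topology ?I (subtopology K (star v))) X
     ((\<lambda>(s, y). cone v s y) \<circ> (\<lambda>(s, t). (s, q t)))"
    by (rule continuous_map_eq) (auto simp: cone_q v)
  then show ?thesis
    by (rule continuous_compose_quotient_map[OF quot2])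
qed

text \<open>The value at a point of the orbit space of the potential built below is independent of
the representative, by invariance, and of the vertex of its carrier from which one starts, by the
triangle rule for spokes.\<close>

lemma potential_well_defined:
  assumes c: "singular_1_cocycle X c"
    and edge: "\<And>v w. v \<in> P \<Longrightarrow> w \<in> P \<Longrightarrow> v < w \<Longrightarrow> c (spoke v (vertex w)) = f w - f v"
    and inv: "\<And>g v. g \<in> carrier G \<Longrightarrow> v \<in> P \<Longrightarrow> f (\<phi> g v) = f v"
    and eq: "q t = q t'" and t: "t \<in> star v" "v \<in> P" and t': "t' \<in> star u" "u \<in> P"
  shows "f v + c (spoke v t) = f u + c (spoke u t')"
proof -
  obtain g where g: "g \<in> carrier G" "t = A g t'"
    using q_eqD[OF eq] t by (auto simp: star_def)
  \<comment> \<open>Move both base vertices into the carrier of the same representative.\<close>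
  define w where "w = \<phi> g u"
  have w: "w \<in> P" "t \<in> star w" "spoke u t' = spoke w t" "f w = f u"
    unfolding w_def using g t' t inv by (auto simp: star_def spoke_A)
  have "v \<le> w \<or> w \<le> v"
    using topspace_KD(4)[of t v w] t w(1,2) by (auto simp: star_def)
  then have "c (spoke v (vertex w)) = f w - f v"
    using edge[OF t(2) w(1)] edge[OF w(1) t(2)] spoke_vertex_same[OF c t(2)]
      spoke_vertex_swap[OF c t(1) w(2) t(2) w(1)] by (auto simp: le_less)
  then show ?thesis
    using spoke_add[OF c t(1) w(2) t(2) w(1)] w by simp
qed

text \<open>This gives injectivity of the comparison map: a singular cocycle that is a coboundary
on the edges is a coboundary. The potential at \<open>q t\<close> is the given potential at a
vertex \<open>v\<close> of the carrier of \<open>t\<close> plus the value of \<open>c\<close> on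
the spoke from \<open>v\<close> to \<open>t\<close>. A path inside the image of the star of
\<open>v\<close> is contracted to the centre by the cone, and the two sides of this homotopy are
spokes; so the claim holds for short paths, and therefore for all.\<close>

lemma cocycle_is_coboundary_if_edges:
  assumes c: "singular_1_cocycle X c"
    and edge: "\<And>v w. v \<in> P \<Longrightarrow> w \<in> P \<Longrightarrow> v < w \<Longrightarrow> c (spoke v (vertex w)) = f w - f v"
    and inv: "\<And>g v. g \<in> carrier G \<Longrightarrow> v \<in> P \<Longrightarrow> f (\<phi> g v) = f v"
  obtains \<beta> where "\<And>H. continuous_map (top_of_set {0..1::real}) X H \<Longrightarrow>
    c (line_simplex H 0 1) = \<beta> (H 1) - \<beta> (H 0)"
proof -
  \<comment> \<open>A representative of the orbit \<open>y\<close> together with a vertex of its carrier.\<close>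
  define rep where "rep y = (SOME p. snd p \<in> P \<and> fst p \<in> star (snd p) \<and> q (fst p) = y)" for y
  define \<beta> where "\<beta> y = f (snd (rep y)) + c (spoke (snd (rep y)) (fst (rep y)))" for y
  have \<beta>: "\<beta> (q t) = f v + c (spoke v t)" if "t \<in> star v" "v \<in> P" for t v
  proof -
    have "snd (rep (q t)) \<in> P \<and> fst (rep (q t)) \<in> star (snd (rep (q t))) \<and> q (fst (rep (q t))) = q t"
      unfolding rep_def by (rule someI_ex) (use that in \<open>auto intro!: exI[of _ "(t, v)"]\<close>)
    then show ?thesis
      unfolding \<beta>_def using potential_well_defined[OF c edge inv] that by blast
  qed
  have "c (line_simplex H 0 1) = \<beta> (H 1) - \<beta> (H 0)"
    if H: "continuous_map (top_of_set {0..1::real}) X H" for H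
  proof (rule locally_coboundary_imp_coboundary[OF c _ H])
    fix y assume "y \<in> topspace X"
    then obtain t where t: "t \<in> topspace K" "y = q t" by (rule X_cases)
    obtain v where v: "v \<in> P" "t v \<noteq> 0" using support_nonempty[OF t(1)] .
    let ?U = "q ` star v"
    have "c (line_simplex L l u) = \<beta> (L u) - \<beta> (L l)"
      if L: "l \<le> u" "continuous_map (top_of_set {l..u}) X L" "L ` {l..u} \<subseteq> ?U" for l u :: real and L
    proof -
      \<comment> \<open>Contract the path towards the centre: stage \<open>0\<close> is constant and stage \<open>1\<close> is the path.\<close>
      let ?H = "\<lambda>(s, \<tau>). cone v s (L \<tau>)"
      have "continuous_map (prod_topology (top_of_set {0..1}) (top_of_set {l..u}))
         (prod_topology (top_of_set {0..1::real}) (subtopology X ?U)) (\<lambda>z. (fst z, L (snd z)))"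
        unfolding continuous_map_paired
      proof
        show "continuous_map (prod_topology (top_of_set {0..1}) (top_of_set {l..u})) (top_of_set {0..1}) fst"
          by (rule continuous_map_fst)
        have "continuous_map (top_of_set {l..u}) (subtopology X ?U) L"
          using L(2,3) by (auto simp: continuous_map_in_subtopology)
        from continuous_map_compose[OF continuous_map_snd[where X = "top_of_set {0..1::real}"] this]
        show "continuous_map (prod_topology (top_of_set {0..1::real}) (top_of_set {l..u})) (subtopology X ?U) (\<lambda>z. L (snd z))"
          by (simp add: o_def)
      qed
      from continuous_map_compose[OF this continuous_map_cone[OF v(1)]]
      have cont: "continuous_map (top_of_set ({0..1} \<times> {l..u})) X ?H"
        by (simp add: o_def case_prod_unfold)
      have lift: "\<exists>t. t \<in> star v \<and> L \<tau> = q t" if "\<tau> \<in> {l..u}" for \<tau>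
        using L(3) that by (blast dest: subsetD[OF _ imageI])
      have "c (line_simplex (\<lambda>\<tau>. ?H (1, \<tau>)) l u) =
          c (line_simplex (\<lambda>s. ?H (s, u)) 0 1) - c (line_simplex (\<lambda>s. ?H (s, l)) (0::real) 1)"
      proof (rule singular_1_cocycle_homotopy[OF c cont])
        fix \<tau> assume "\<tau> \<in> {l..u}"
        then obtain t where t: "t \<in> star v" "L \<tau> = q t" using lift by blast
        then show "?H (0, \<tau>) = q (vertex v)"
          using v by (simp add: cone_q segment_0)
      qed (use L in auto)
      moreover have "line_simplex (\<lambda>\<tau>. ?H (1, \<tau>)) l u = line_simplex L l u"
      proof (rule line_simplex_eqI)
        fix s :: real assume "0 \<le> s" "s \<le> 1"
        then have "(1 - s) *\<^sub>R l + s *\<^sub>R u \<in> {l..u}"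
          using L(1) by (intro convexD_alt) auto
        then obtain t where t: "t \<in> star v" "L ((1 - s) *\<^sub>R l + s *\<^sub>R u) = q t" using lift by blast
        then show "?H (1, (1 - s) *\<^sub>R l + s *\<^sub>R u) = L ((1 - s) *\<^sub>R l + s *\<^sub>R u)"
          using v by (simp add: cone_q segment_1 star_def)
      qed
      moreover have "c (line_simplex (\<lambda>s. ?H (s, \<tau>)) (0::real) 1) = \<beta> (L \<tau>) - f v" if \<tau>: "\<tau> \<in> {l..u}" for \<tau>
      proof -
        obtain t where t: "t \<in> star v" "L \<tau> = q t" using lift[OF \<tau>] by blast
        then show ?thesis using v \<beta>[OF t(1) v(1)] by (simp add: cone_q spoke_def)
      qed
      ultimately show ?thesis using L(1) by simp
    qed
    moreover have "openin X ?U" "y \<in> ?U"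
      using open_map_q openin_star[OF v(1)] t v by (auto simp: open_map_def star_def)
    ultimately show "\<exists>U. openin X U \<and> y \<in> U \<and>
      (\<forall>l u H. l \<le> u \<longrightarrow> continuous_map (top_of_set {l..u}) X H \<longrightarrow> H ` {l..u} \<subseteq> U \<longrightarrow>
         c (line_simplex H (l::real) u) = \<beta> (H u) - \<beta> (H l))" by blast
  qed
  then show ?thesis using that by blast
qed

section \<open>Cocycles with prescribed values on edges\<close>

text \<open>The antisymmetric extension of an edge cochain, for which the cocycle condition holds
for three comparable vertices in any order.\<close>

definition signed_edge :: "('v \<Rightarrow> 'v \<Rightarrow> int) \<Rightarrow> 'v \<Rightarrow> 'v \<Rightarrow> int" where
  "signed_edge f v w = (if v < w then f v w else if w < v then - f w v else 0)"

text \<open>The affine extension over the star of \<open>v\<close> of the function that takes the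
value \<open>signed_edge f v w\<close> at each vertex \<open>w\<close>: the angle, in full turns,
of a circle-valued map that winds around that many times along the edge from \<open>v\<close> to
\<open>w\<close>.\<close>

definition angle :: "('v \<Rightarrow> 'v \<Rightarrow> int) \<Rightarrow> 'v \<Rightarrow> ('v \<Rightarrow> real) \<Rightarrow> real" where
  "angle f v t = (\<Sum>w\<in>P. t w * of_int (signed_edge f v w))"

lemma signed_edge_add:
  assumes cocycle: "\<And>u v w. u \<in> P \<Longrightarrow> v \<in> P \<Longrightarrow> w \<in> P \<Longrightarrow> u < v \<Longrightarrow> v < w \<Longrightarrow> f u v + f v w = f u w"
    and P: "u \<in> P" "v \<in> P" "w \<in> P"
    and comparable: "u \<le> v \<or> v \<le> u" "u \<le> w \<or> w \<le> u" "v \<le> w \<or> w \<le> v"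
  shows "signed_edge f u w = signed_edge f u v + signed_edge f v w"
proof -
  have total: "u < v \<or> u = v \<or> v < u" "u < w \<or> u = w \<or> w < u" "v < w \<or> v = w \<or> w < v"
    using comparable by (auto simp: le_less)
  have "x < y \<Longrightarrow> \<not> y < x" "x < y \<Longrightarrow> y < z \<Longrightarrow> x < z" for x y z :: 'v
    by auto
  then show ?thesis
    using total cocycle[OF P(1,2,3)] cocycle[OF P(1,3,2)] cocycle[OF P(2,1,3)]
      cocycle[OF P(2,3,1)] cocycle[OF P(3,1,2)] cocycle[OF P(3,2,1)]
    unfolding signed_edge_def by (smt (verit))
qed

text \<open>Since barycentric coordinates add up to one, changing the base vertex changes the
angle by an integer.\<close>

lemma angle_change_base:
  assumes cocycle: "\<And>u v w. u \<in> P \<Longrightarrow> v \<in> P \<Longrightarrow> w \<in> P \<Longrightarrow> u < v \<Longrightarrow> v < w \<Longrightarrow> f u v + f v w = f u w"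
    and t: "t \<in> star u" "t \<in> star v" and P: "u \<in> P" "v \<in> P"
  shows "angle f u t = of_int (signed_edge f u v) + angle f v t"
proof -
  have K: "t \<in> topspace K" using t by (simp add: star_def)
  have "t w * of_int (signed_edge f u w) = t w * of_int (signed_edge f u v) + t w * of_int (signed_edge f v w)"
    if w: "w \<in> P" for w
  proof (cases "t w = 0")
    case False
    have "signed_edge f u w = signed_edge f u v + signed_edge f v w"
      by (rule signed_edge_add) (use cocycle topspace_KD(4)[OF K] t P w False in \<open>auto simp: star_def\<close>)
    then show ?thesis by (simp add: distrib_left)
  qed simp
  then have "angle f u t = (\<Sum>w\<in>P. t w) * of_int (signed_edge f u v) + angle f v t"
    unfolding angle_def by (simp add: sum.distrib sum_distrib_right)
  then show ?thesis using topspace_KD(3)[OF K] by simp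
qed

lemma angle_A:
  assumes inv: "\<And>g v w. g \<in> carrier G \<Longrightarrow> v \<in> P \<Longrightarrow> w \<in> P \<Longrightarrow> v < w \<Longrightarrow> f (\<phi> g v) (\<phi> g w) = f v w"
    and g: "g \<in> carrier G" and v: "v \<in> P"
  shows "angle f (\<phi> g v) (A g t) = angle f v t"
proof -
  have "angle f (\<phi> g v) (A g t) = (\<Sum>w\<in>P. A g t (\<phi> g w) * of_int (signed_edge f (\<phi> g v) (\<phi> g w)))"
    unfolding angle_def by (rule sum.reindex_bij_betw[OF bij_betw_act[OF g], symmetric])
  also have "\<dots> = angle f v t"
    unfolding angle_def using g v inv
    by (intro sum.cong) (simp_all add: signed_edge_def act_less_iff)
  finally show ?thesis .
qed

text \<open>By the previous lemmas the point of the circle with angle \<open>angle f v t\<close>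
depends neither on \<open>v\<close> nor on \<open>t\<close> within its orbit. Continuity is
checked on the open stars, where a single formula applies.\<close>

lemma circle_map_exists:
  assumes cocycle: "\<And>u v w. u \<in> P \<Longrightarrow> v \<in> P \<Longrightarrow> w \<in> P \<Longrightarrow> u < v \<Longrightarrow> v < w \<Longrightarrow> f u v + f v w = f u w"
    and inv: "\<And>g v w. g \<in> carrier G \<Longrightarrow> v \<in> P \<Longrightarrow> w \<in> P \<Longrightarrow> v < w \<Longrightarrow> f (\<phi> g v) (\<phi> g w) = f v w"
  obtains F where "continuous_map X euclidean F"
    "\<And>t v. v \<in> P \<Longrightarrow> t \<in> star v \<Longrightarrow> F (q t) = cis (2 * pi * angle f v t)"
proof -
  define rep where "rep y = (SOME p. snd p \<in> P \<and> fst p \<in> star (snd p) \<and> q (fst p) = y)" for y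
  define F where "F y = cis (2 * pi * angle f (snd (rep y)) (fst (rep y)))" for y
  have F: "F (q t) = cis (2 * pi * angle f v t)" if t: "v \<in> P" "t \<in> star v" for t v
  proof -
    obtain t' u where rep': "rep (q t) = (t', u)" by fastforce
    have "snd (rep (q t)) \<in> P \<and> fst (rep (q t)) \<in> star (snd (rep (q t))) \<and> q (fst (rep (q t))) = q t"
      unfolding rep_def by (rule someI_ex) (use that in \<open>auto intro!: exI[of _ "(t, v)"]\<close>)
    then have t': "u \<in> P" "t' \<in> star u" "q t' = q t" by (auto simp: rep')
    then obtain g where g: "g \<in> carrier G" "t' = A g t"
      using q_eqD[of t' t] by (auto simp: star_def)
    have gv: "\<phi> g v \<in> P" "t' \<in> star (\<phi> g v)" using g t t'(2) by (auto simp: star_def)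
    have "angle f u t' = of_int (signed_edge f u (\<phi> g v)) + angle f (\<phi> g v) t'"
      by (rule angle_change_base[OF cocycle t'(2) gv(2) t'(1) gv(1)])
    also have "angle f (\<phi> g v) t' = angle f v t"
      using angle_A[where f = f and g = g and v = v and t = t] inv g t(1) by blast
    finally have "cis (2 * pi * angle f u t') = cis (2 * pi * angle f v t)"
      by (simp add: distrib_left flip: cis_mult)
    then show ?thesis by (simp add: F_def rep')
  qed
  have "continuous_map K euclidean (F \<circ> q)"
  proof (rule pasting_lemma[where I = P and T = star and f = "\<lambda>v t. cis (2 * pi * angle f v t)"])
    fix v assume v: "v \<in> P"
    then show "openin K (star v)" by (rule openin_star)
    have "continuous_map K euclideanreal (\<lambda>t. 2 * pi * angle f v t)"
      unfolding angle_def
      by (intro continuous_intros continuous_map_coordinate finite_P)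
    moreover have "continuous_map euclideanreal euclidean cis"
      by (simp add: continuous_on_cis)
    ultimately have "continuous_map K euclidean (cis \<circ> (\<lambda>t. 2 * pi * angle f v t))"
      by (rule continuous_map_compose)
    then show "continuous_map (subtopology K (star v)) euclidean (\<lambda>t. cis (2 * pi * angle f v t))"
      by (simp add: o_def continuous_map_from_subtopology)
  next
    fix u v t assume "u \<in> P" "v \<in> P" "t \<in> topspace K \<inter> star u \<inter> star v"
    then show "cis (2 * pi * angle f u t) = cis (2 * pi * angle f v t)"
      using F[of u t] F[of v t] by simp
  next
    fix t assume t: "t \<in> topspace K"
    then obtain v where "v \<in> P" "t v \<noteq> 0" by (rule support_nonempty)
    then show "\<exists>v. v \<in> P \<and> t \<in> star v \<and> (F \<circ> q) t = cis (2 * pi * angle f v t)"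
      using t F[of v t] by (auto simp: star_def)
  qed
  then have "continuous_map X euclidean F"
    by (rule continuous_compose_quotient_map[OF quotient_map_orbit])
  then show ?thesis using that F by blast
qed

lemma angle_segment:
  assumes "v \<in> P" "w \<in> P"
  shows "angle f v (segment (vertex v) (vertex w) s) = s * of_int (signed_edge f v w)"
proof -
  have "angle f v (segment (vertex v) (vertex w) s) =
      (\<Sum>x\<in>P. if x = w then s * of_int (signed_edge f v w) else 0)"
    unfolding angle_def
    by (intro sum.cong) (auto simp: segment_def vertex_def signed_edge_def)
  then show ?thesis using finite_P assms by simp
qed

text \<open>This gives surjectivity of the comparison map. The circle-valued map sends every
vertex to \<open>1\<close>, where \<open>Arg\<close> vanishes, so the pulled back cocycle takes on
an edge exactly the winding number, which is the prescribed value.\<close>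

lemma cocycle_with_given_edges:
  assumes cocycle: "\<And>u v w. u \<in> P \<Longrightarrow> v \<in> P \<Longrightarrow> w \<in> P \<Longrightarrow> u < v \<Longrightarrow> v < w \<Longrightarrow> f u v + f v w = f u w"
    and inv: "\<And>g v w. g \<in> carrier G \<Longrightarrow> v \<in> P \<Longrightarrow> w \<in> P \<Longrightarrow> v < w \<Longrightarrow> f (\<phi> g v) (\<phi> g w) = f v w"
  obtains c where "singular_1_cocycle X c"
    "\<And>v w. v \<in> P \<Longrightarrow> w \<in> P \<Longrightarrow> v < w \<Longrightarrow> c (spoke v (vertex w)) = f v w"
proof -
  obtain F where F: "continuous_map X euclidean F"
    and Fq: "\<And>t v. v \<in> P \<Longrightarrow> t \<in> star v \<Longrightarrow> F (q t) = cis (2 * pi * angle f v t)"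
    using circle_map_exists[of f] assms by blast
  have vertex: "F (q (vertex v)) = 1" if v: "v \<in> P" for v
    using Fq[OF v vertex_in_star[OF v]] angle_segment[OF v v, of f 0] segment_same[OF vertex_in_K[OF v]] v
    by (simp add: segment_0)
  have "norm (F y) = 1" if y: "y \<in> topspace X" for y
  proof -
    obtain t where t: "t \<in> topspace K" "y = q t" using y by (rule X_cases)
    obtain v where "v \<in> P" "t v \<noteq> 0" using support_nonempty[OF t(1)] .
    then show ?thesis using Fq[of v t] t by (simp add: star_def)
  qed
  then have "singular_1_cocycle X (circle_cochain F)"
    using F by (intro singular_1_cocycle_circle_cochain)
  moreover have "circle_cochain F (spoke v (vertex w)) = f v w"
    if v: "v \<in> P" and w: "w \<in> P" and less: "v < w" for v w
  proof -
    let ?H = "\<lambda>s. q (segment (vertex v) (vertex w) s)"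
    have "F (?H s) = cis (2 * pi * (s * of_int (f v w)))" if s: "s \<in> {0..1}" for s
    \<comment> \<open>At the far end the base vertex has left the carrier, so this end is treated by itself.\<close>
    proof (cases "s = 1")
      case True
      then show ?thesis using vertex[OF w] w by (simp add: segment_1)
    next
      case False
      have "segment (vertex v) (vertex w) s \<in> topspace K"
        unfolding topspace_K_iff
      proof (intro conjI ballI impI)
        have "(\<Sum>x\<in>P. segment (vertex v) (vertex w) s x) =
            (1 - s) * (\<Sum>x\<in>P. vertex v x) + s * (\<Sum>x\<in>P. vertex w x)"
          by (simp add: segment_def sum.distrib sum_distrib_left)
        then show "(\<Sum>x\<in>P. segment (vertex v) (vertex w) s x) = 1"
          using topspace_KD(3)[OF vertex_in_K] v w by simp
        fix x y assume "x \<in> P" "y \<in> P"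
          "segment (vertex v) (vertex w) s x \<noteq> 0 \<and> segment (vertex v) (vertex w) s y \<noteq> 0"
        then have "x \<in> {v, w}" "y \<in> {v, w}" by (auto simp: segment_def vertex_def split: if_splits)
        then show "x \<le> y \<or> y \<le> x" using less by auto
      qed (use s in \<open>auto simp: segment_def vertex_def\<close>)
      then have "segment (vertex v) (vertex w) s \<in> star v"
        using False v less by (simp add: star_def) (simp add: segment_def vertex_def)
      then show ?thesis
        using Fq[OF v] angle_segment[OF v w] less by (simp add: signed_edge_def)
    qed
    then have "real_of_int (circle_cochain F (line_simplex ?H 0 1)) =
      (1 * of_int (f v w) - 0 * of_int (f v w)) - (Arg (F (?H 1)) - Arg (F (?H 0))) / (2 * pi)"
      by (intro circle_cochain_line[where S = "{0..1}"] convex_real_interval continuous_intros) auto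
    then have "real_of_int (circle_cochain F (line_simplex ?H 0 1)) = of_int (f v w)"
      using v w vertex by (simp add: segment_0 segment_1)
    then show ?thesis unfolding spoke_def of_int_eq_iff .
  qed
  ultimately show ?thesis using that by blast
qed

section \<open>The cells of the orbit space\<close>

text \<open>The affine map from the standard simplex onto the closed simplex of the order complex
spanned by \<open>\<sigma>\<close>.\<close>

definition bary :: "'v list \<Rightarrow> (nat \<Rightarrow> real) \<Rightarrow> 'v \<Rightarrow> real" where
  "bary \<sigma> x = (\<lambda>w\<in>P. \<Sum>i<length \<sigma>. if \<sigma> ! i = w then x i else 0)"

text \<open>The characteristic map of the cell of the orbit space that corresponds to the orbit of
\<open>\<sigma>\<close>.\<close>

definition realize :: "'v list \<Rightarrow> (nat \<Rightarrow> real) \<Rightarrow> ('v \<Rightarrow> real) set" where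
  "realize \<sigma> = (\<lambda>x \<in> standard_simplex (length \<sigma> - 1). q (bary \<sigma> x))"

lemma bary_in_K:
  assumes \<sigma>: "\<sigma> \<in> order_simplices P n" and x: "x \<in> standard_simplex n"
  shows "bary \<sigma> x \<in> topspace K"
  unfolding topspace_K_iff
proof (intro conjI ballI impI)
  have len: "length \<sigma> = Suc n" and set: "set \<sigma> \<subseteq> P" and sorted: "sorted_wrt (<) \<sigma>"
    using \<sigma> by (auto simp: order_simplices_def)
  have "(\<Sum>w\<in>P. bary \<sigma> x w) = (\<Sum>i<length \<sigma>. \<Sum>w\<in>P. if \<sigma> ! i = w then x i else 0)"
    by (simp add: bary_def sum.swap[of _ P])
  also have "\<dots> = (\<Sum>i<length \<sigma>. x i)"
  proof (intro sum.cong refl)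
    fix i assume "i \<in> {..<length \<sigma>}"
    then have "\<sigma> ! i \<in> P" using set nth_mem by blast
    then show "(\<Sum>w\<in>P. if \<sigma> ! i = w then x i else 0) = x i" using finite_P by simp
  qed
  also have "\<dots> = 1" using x by (simp add: len standard_simplex_def lessThan_Suc_atMost)
  finally show "(\<Sum>w\<in>P. bary \<sigma> x w) = 1" .
  show "0 \<le> bary \<sigma> x v" if "v \<in> P" for v
    using that x by (auto simp: bary_def standard_simplex_def intro!: sum_nonneg)
  have support: "v \<in> set \<sigma>" if "v \<in> P" "bary \<sigma> x v \<noteq> 0" for v
  proof (rule ccontr)
    assume "v \<notin> set \<sigma>"
    then have "bary \<sigma> x v = 0" using that(1) by (auto simp: bary_def intro!: sum.neutral)
    then show False using that(2) by simp
  qed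
  fix v w assume "v \<in> P" "w \<in> P" "bary \<sigma> x v \<noteq> 0 \<and> bary \<sigma> x w \<noteq> 0"
  then obtain i j where "i < length \<sigma>" "j < length \<sigma>" "v = \<sigma> ! i" "w = \<sigma> ! j"
    using support by (metis in_set_conv_nth)
  then show "v \<le> w \<or> w \<le> v"
    using sorted by (metis sorted_wrt_nth_less less_imp_le linorder_cases order_refl)
qed (simp add: bary_def)

lemma singular_simplex_realize:
  assumes \<sigma>: "\<sigma> \<in> order_simplices P n"
  shows "singular_simplex n X (realize \<sigma>)"
proof -
  have len: "length \<sigma> = Suc n" using \<sigma> by (simp add: order_simplices_def)
  have "continuous_map (top_of_set (standard_simplex n)) K (bary \<sigma>)"
  proof (rule continuous_map_into_K)
    fix w assume w: "w \<in> P"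
    have "continuous_on (standard_simplex n) (\<lambda>x. if \<sigma> ! i = w then x i else 0)" for i
      by (cases "\<sigma> ! i = w") (auto intro: continuous_on_subset[OF continuous_on_product_coordinates])
    then show "continuous_map (top_of_set (standard_simplex n)) euclideanreal (\<lambda>x. bary \<sigma> x w)"
      using w by (auto simp: bary_def intro!: continuous_on_sum)
  qed (use bary_in_K[OF \<sigma>] in auto)
  from continuous_map_compose[OF this continuous_map_q]
  have "continuous_map (top_of_set (standard_simplex n)) X (\<lambda>x \<in> standard_simplex n. q (bary \<sigma> x))"
    by (rule continuous_map_eq) simp
  then show ?thesis
    by (simp add: singular_simplex_euclidean_iff realize_def len)
qed

lemma map_act_in_order_simplices:
  "g \<in> carrier G \<Longrightarrow> \<sigma> \<in> order_simplices P n \<Longrightarrow> map (\<phi> g) \<sigma> \<in> order_simplices P n"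
  by (auto simp: order_simplices_def sorted_wrt_map act_less_iff subset_iff
      intro: sorted_wrt_mono_rel[of \<sigma> "(<)"])

lemma realize_map_act:
  assumes g: "g \<in> carrier G" and \<sigma>: "\<sigma> \<in> order_simplices P n"
  shows "realize (map (\<phi> g) \<sigma>) = realize \<sigma>"
proof -
  have "bary (map (\<phi> g) \<sigma>) x = A g (bary \<sigma> x)" for x
  proof (rule extensionalityI[of _ P])
    fix w assume w: "w \<in> P"
    have "\<phi> g (\<sigma> ! i) = w \<longleftrightarrow> \<sigma> ! i = \<phi> (inv g) w" if "i < length \<sigma>" for i
    proof -
      have "\<sigma> ! i \<in> P" using that \<sigma> by (auto simp: order_simplices_def subset_iff)
      then show ?thesis using g w by auto
    qed
    then show "bary (map (\<phi> g) \<sigma>) x w = A g (bary \<sigma> x) w"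
      using g w by (simp add: bary_def A_apply)
  qed (simp_all add: bary_def)
  then show ?thesis
    using g by (simp add: realize_def)
qed

lemma bary_simplical_face:
  assumes \<sigma>: "length \<sigma> = Suc (Suc n)" and k: "k \<le> Suc n"
  shows "bary \<sigma> (simplical_face k x) = bary (order_face k \<sigma>) x"
proof -
  have len: "length (order_face k \<sigma>) = Suc n" using \<sigma> k by (simp add: order_face_def)
  have "(\<Sum>i<Suc (Suc n). if \<sigma> ! i = w then simplical_face k x i else 0) =
      (\<Sum>i<Suc n. if order_face k \<sigma> ! i = w then x i else 0)" (is "?L = ?R") for w
  proof -
    have "?L = (\<Sum>i\<in>{..<Suc (Suc n)} - {k}. if \<sigma> ! i = w then simplical_face k x i else 0)"
      using k by (intro sum.mono_neutral_right) (auto simp: simplical_face_def)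
    also have "\<dots> = ?R"
      by (rule sum.reindex_bij_witness[where i = "\<lambda>i. if i < k then i else Suc i"
            and j = "\<lambda>i. if i < k then i else i - 1"])
         (use k \<sigma> in \<open>auto simp: nth_order_face simplical_face_def\<close>)
    finally show ?thesis .
  qed
  then show ?thesis by (simp add: bary_def len \<sigma> fun_eq_iff restrict_def del: sum.lessThan_Suc)
qed

text \<open>Since chains are listed in increasing order, faces of characteristic maps are
characteristic maps of faces. This is what makes restriction to cells a cochain map.\<close>

lemma singular_face_realize:
  assumes \<sigma>: "\<sigma> \<in> order_simplices P (Suc n)" and k: "k \<le> Suc n"
  shows "singular_face (Suc n) k (realize \<sigma>) = realize (order_face k \<sigma>)"
proof -
  have len: "length \<sigma> = Suc (Suc n)" using \<sigma> by (simp add: order_simplices_def)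
  have len': "length (order_face k \<sigma>) = Suc n" using len k by (simp add: order_face_def)
  show ?thesis
    using k by (simp add: realize_def len len')
      (simp add: singular_face_def o_def bary_simplical_face[OF len k])
qed

lemma realize_edge:
  assumes "v \<in> P" "w \<in> P" "v < w"
  shows "realize [v, w] = spoke v (vertex w)"
proof -
  have "bary [v, w] x = segment (vertex v) (vertex w) (x 1)" if "x \<in> standard_simplex 1" for x
  proof (rule extensionalityI[of _ P])
    fix y assume "y \<in> P"
    moreover have "x 0 = 1 - x 1" using standard_simplex_1D[OF that] by simp
    ultimately show "bary [v, w] x y = segment (vertex v) (vertex w) (x 1) y"
      using assms by (auto simp: bary_def segment_def vertex_def)
  qed (simp_all add: bary_def segment_def)
  then show ?thesis
    unfolding realize_def spoke_def line_simplex_def by (intro ext) (simp add: restrict_def)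
qed

section \<open>Comparison of invariant and singular cohomology\<close>

abbreviation invariant_cochains :: "nat \<Rightarrow> ('v list \<Rightarrow> int) set" where
  "invariant_cochains n \<equiv> carrier (invariant_order_cochain_group G \<phi> P n)"

lemma invariant_cochains_iff:
  "f \<in> invariant_cochains n \<longleftrightarrow> f \<in> order_simplices P n \<rightarrow>\<^sub>E UNIV \<and>
     (\<forall>g \<in> carrier G. \<forall>\<sigma> \<in> order_simplices P n. f (map (\<phi> g) \<sigma>) = f \<sigma>)"
  by (simp add: invariant_order_cochain_group_def)

lemma subgroup_invariant_cochains:
  "subgroup (invariant_cochains n) (integer_functions (order_simplices P n))"
proof -
  interpret C: group "integer_functions (order_simplices P n)"
    using comm_group_integer_functions by (rule comm_group.axioms)
  show ?thesis
  proof (rule C.subgroupI)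
    show "invariant_cochains n \<subseteq> carrier (integer_functions (order_simplices P n))"
      by (auto simp: invariant_cochains_iff integer_functions_simps)
    have "(\<lambda>\<sigma>\<in>order_simplices P n. 0) \<in> invariant_cochains n"
      by (simp add: invariant_cochains_iff map_act_in_order_simplices)
    then show "invariant_cochains n \<noteq> {}" by blast
    fix f assume f: "f \<in> invariant_cochains n"
    then have "inv\<^bsub>integer_functions (order_simplices P n)\<^esub> f = (\<lambda>\<sigma>\<in>order_simplices P n. - f \<sigma>)"
      by (subst inv_product_group) (auto simp: invariant_cochains_iff integer_functions_simps)
    then show "inv\<^bsub>integer_functions (order_simplices P n)\<^esub> f \<in> invariant_cochains n"
      using f by (simp add: invariant_cochains_iff map_act_in_order_simplices)
    fix g assume "g \<in> invariant_cochains n"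
    with f show "f \<otimes>\<^bsub>integer_functions (order_simplices P n)\<^esub> g \<in> invariant_cochains n"
      by (simp add: invariant_cochains_iff integer_functions_simps map_act_in_order_simplices)
  qed
qed

text \<open>The comparison map: evaluate a singular cochain of the orbit space on the
cells.\<close>

definition restrict_cochain :: "nat \<Rightarrow> (((nat \<Rightarrow> real) \<Rightarrow> ('v \<Rightarrow> real) set) \<Rightarrow> int) \<Rightarrow> 'v list \<Rightarrow> int" where
  "restrict_cochain n c = (\<lambda>\<sigma> \<in> order_simplices P n. c (realize \<sigma>))"

lemma restrict_cochain_invariant: "restrict_cochain n c \<in> invariant_cochains n"
  by (simp add: invariant_cochains_iff restrict_cochain_def map_act_in_order_simplices realize_map_act)

lemma restrict_cochain_hom:
  "restrict_cochain n \<in> hom (singular_cochain_group X n) (integer_functions (order_simplices P n))"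
  unfolding singular_cochain_group_def
  by (rule homI) (auto simp: integer_functions_simps restrict_cochain_def singular_simplex_realize)

lemma restrict_cochain_coboundary:
  "restrict_cochain (Suc n) (singular_coboundary X n c) = order_coboundary P n (restrict_cochain n c)"
proof -
  have "singular_coboundary X n c (realize \<sigma>) = order_coboundary P n (restrict_cochain n c) \<sigma>"
    if \<sigma>: "\<sigma> \<in> order_simplices P (Suc n)" for \<sigma>
    using \<sigma> singular_simplex_realize[OF \<sigma>]
    by (simp add: singular_coboundary_def order_coboundary_def restrict_cochain_def
        singular_face_realize order_face_in_order_simplices del: sum.atMost_Suc)
  then show ?thesis
    by (auto simp: restrict_cochain_def order_coboundary_def fun_eq_iff)
qed

lemma invariant_1_cocycle_iff:
  assumes "f \<in> order_simplices P 1 \<rightarrow>\<^sub>E UNIV"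
  shows "order_coboundary P 1 f = \<one>\<^bsub>integer_functions (order_simplices P 2)\<^esub> \<longleftrightarrow>
    (\<forall>u\<in>P. \<forall>v\<in>P. \<forall>w\<in>P. u < v \<longrightarrow> v < w \<longrightarrow> f [u, v] + f [v, w] = f [u, w])" (is "?L \<longleftrightarrow> ?R")
proof
  assume ?L
  show ?R
  proof (intro ballI impI)
    fix u v w assume *: "u \<in> P" "v \<in> P" "w \<in> P" "u < v" "v < w"
    then have "order_coboundary P 1 f [u, v, w] = 0"
      using \<open>?L\<close> order_simplices_2[of u v w P] by (simp add: integer_functions_simps)
    then show "f [u, v] + f [v, w] = f [u, w]"
      using order_coboundary_triangle[OF *] by simp
  qed
next
  assume R: ?R
  show ?L
  proof
    fix \<sigma>
    show "order_coboundary P 1 f \<sigma> = \<one>\<^bsub>integer_functions (order_simplices P 2)\<^esub> \<sigma>"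
    proof (cases "\<sigma> \<in> order_simplices P 2")
      case True
      then obtain u v w where *: "\<sigma> = [u, v, w]" "u \<in> P" "v \<in> P" "w \<in> P" "u < v" "v < w"
        by (rule order_simplices_2E)
      then have "f [u, v] + f [v, w] = f [u, w]" using R by blast
      then have "order_coboundary P 1 f \<sigma> = 0"
        unfolding *(1) order_coboundary_triangle[OF *(2-)] by simp
      then show ?thesis using True by (simp add: integer_functions_simps)
    next
      case False
      then show ?thesis
        by (simp add: integer_functions_simps order_coboundary_def numeral_2_eq_2)
    qed
  qed
qed

definition singular_cocycles where
  "singular_cocycles = {c \<in> singular_simplex_set 1 X \<rightarrow>\<^sub>E UNIV. singular_1_cocycle X c}"

definition singular_coboundaries where
  "singular_coboundaries = singular_coboundary X 0 ` (singular_simplex_set 0 X \<rightarrow>\<^sub>E UNIV)"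

definition invariant_cocycles where
  "invariant_cocycles = {f \<in> invariant_cochains 1.
     \<forall>u\<in>P. \<forall>v\<in>P. \<forall>w\<in>P. u < v \<longrightarrow> v < w \<longrightarrow> f [u, v] + f [v, w] = f [u, w]}"

definition invariant_coboundaries where
  "invariant_coboundaries = order_coboundary P 0 ` invariant_cochains 0"

lemma kernel_singular:
  "kernel (singular_cochain_group X 1) (singular_cochain_group X 2) (singular_coboundary X 1) = singular_cocycles"
  unfolding kernel_def singular_cocycles_def using singular_1_cocycle_iff[of _ X]
  by (auto simp: singular_cochain_group_def integer_functions_simps(1) simp del: one_product_group)

lemma kernel_invariant:
  "kernel (invariant_order_cochain_group G \<phi> P 1) (invariant_order_cochain_group G \<phi> P 2) (order_coboundary P 1) =
    invariant_cocycles"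
proof -
  have "\<one>\<^bsub>invariant_order_cochain_group G \<phi> P 2\<^esub> = \<one>\<^bsub>integer_functions (order_simplices P 2)\<^esub>"
    by (simp add: invariant_order_cochain_group_def)
  then show ?thesis
    unfolding kernel_def invariant_cocycles_def
    by (intro Collect_cong conj_cong refl) (simp only: invariant_cochains_iff invariant_1_cocycle_iff)
qed

lemma singular_cohomology_1:
  "singular_cohomology 1 X =
    (integer_functions (singular_simplex_set 1 X))\<lparr>carrier := singular_cocycles\<rparr> Mod singular_coboundaries"
  unfolding singular_cohomology_def cochain_cohomology_def
  using kernel_singular
  by (simp add: singular_cochain_group_def singular_coboundaries_def integer_functions_simps(1) numeral_2_eq_2)

lemma invariant_cohomology_1:
  "invariant_order_cohomology G \<phi> 1 P =
    (integer_functions (order_simplices P 1))\<lparr>carrier := invariant_cocycles\<rparr> Mod invariant_coboundaries"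
  unfolding invariant_order_cohomology_def cochain_cohomology_def
  using kernel_invariant
  by (simp add: invariant_coboundaries_def numeral_2_eq_2) (simp add: invariant_order_cochain_group_def)

lemma normal_singular_coboundaries:
  "normal singular_coboundaries
    ((integer_functions (singular_simplex_set 1 X))\<lparr>carrier := singular_cocycles\<rparr>)"
proof (rule normal_integer_functions)
  interpret d0: group_hom "singular_cochain_group X 0" "singular_cochain_group X 1" "singular_coboundary X 0"
    using group_hom_singular_coboundary[of X 0] by simp
  interpret d1: group_hom "singular_cochain_group X 1" "singular_cochain_group X 2" "singular_coboundary X 1"
    using group_hom_singular_coboundary[of X 1] by (simp add: numeral_2_eq_2)
  show "subgroup singular_coboundaries (integer_functions (singular_simplex_set 1 X))"
    using d0.img_is_subgroup
    by (simp add: singular_coboundaries_def singular_cochain_group_def integer_functions_simps(1))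
  show "subgroup singular_cocycles (integer_functions (singular_simplex_set 1 X))"
    using d1.subgroup_kernel by (simp only: kernel_singular) (simp add: singular_cochain_group_def)
  show "singular_coboundaries \<subseteq> singular_cocycles"
  proof
    fix c assume "c \<in> singular_coboundaries"
    then obtain b where "c = singular_coboundary X 0 b"
      unfolding singular_coboundaries_def by blast
    moreover have "singular_coboundary X 0 b \<in> singular_simplex_set 1 X \<rightarrow>\<^sub>E UNIV"
      by (simp add: singular_coboundary_def)
    ultimately show "c \<in> singular_cocycles"
      using singular_1_cocycle_coboundary unfolding singular_cocycles_def by blast
  qed
qed

lemma normal_invariant_coboundaries:
  "normal invariant_coboundaries
    ((integer_functions (order_simplices P 1))\<lparr>carrier := invariant_cocycles\<rparr>)"
proof (rule normal_integer_functions)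
  let ?C = "\<lambda>n. integer_functions (order_simplices P n)"
  interpret d0: group_hom "?C 0" "?C 1" "order_coboundary P 0"
    using group_hom_order_coboundary[of P 0] by simp
  interpret d1: group_hom "?C 1" "?C 2" "order_coboundary P 1"
    using group_hom_order_coboundary[of P 1] by (simp add: numeral_2_eq_2)
  show "subgroup invariant_coboundaries (?C 1)"
    unfolding invariant_coboundaries_def
    by (rule d0.subgroup_img_is_subgroup[OF subgroup_invariant_cochains])
  have "invariant_cocycles = invariant_cochains 1 \<inter> kernel (?C 1) (?C 2) (order_coboundary P 1)"
    unfolding invariant_cocycles_def kernel_def
    by (auto simp: invariant_cochains_iff integer_functions_simps(1) invariant_1_cocycle_iff
        simp del: one_product_group One_nat_def)
  then show "subgroup invariant_cocycles (?C 1)"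
    using d0.H.subgroups_Inter_pair[OF subgroup_invariant_cochains d1.subgroup_kernel] by simp
  show "invariant_coboundaries \<subseteq> invariant_cocycles"
  proof
    fix f assume "f \<in> invariant_coboundaries"
    then obtain b where b: "b \<in> invariant_cochains 0" "f = order_coboundary P 0 b"
      by (auto simp: invariant_coboundaries_def)
    have "f \<in> invariant_cochains 1"
      unfolding invariant_cochains_iff
    proof (intro conjI ballI)
      show "f \<in> order_simplices P 1 \<rightarrow>\<^sub>E UNIV" by (simp add: b order_coboundary_def)
      fix g \<sigma> assume g: "g \<in> carrier G" and edge: "\<sigma> \<in> order_simplices P 1"
      obtain v w where \<sigma>: "\<sigma> = [v, w]" "v \<in> P" "w \<in> P" "v < w"
        using edge by (rule order_simplices_1E)
      have "b [\<phi> g x] = b [x]" if "x \<in> P" for x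
        using b(1) g that order_simplices_01(1)[of x P] unfolding invariant_cochains_iff by fastforce
      then show "f (map (\<phi> g) \<sigma>) = f \<sigma>"
        using \<sigma> g by (simp add: b(2) order_coboundary_edge act_less_iff)
    qed
    moreover have "f [u, v] + f [v, w] = f [u, w]"
      if "u \<in> P" "v \<in> P" "w \<in> P" "u < v" "v < w" for u v w
      using that less_trans[OF that(4,5)] by (simp add: b(2) order_coboundary_edge)
    ultimately show "f \<in> invariant_cocycles"
      unfolding invariant_cocycles_def by blast
  qed
qed

lemma restrict_cochain_edge:
  "v \<in> P \<Longrightarrow> w \<in> P \<Longrightarrow> v < w \<Longrightarrow> restrict_cochain 1 c [v, w] = c (spoke v (vertex w))"
  using order_simplices_01(2)[of v w P] by (simp add: restrict_cochain_def realize_edge)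

lemma restrict_cocycle:
  assumes "c \<in> singular_cocycles" shows "restrict_cochain 1 c \<in> invariant_cocycles"
proof -
  have "singular_coboundary X 1 c = \<one>\<^bsub>singular_cochain_group X 2\<^esub>"
    using assms singular_1_cocycle_iff unfolding singular_cocycles_def by blast
  moreover have "restrict_cochain 2 \<one>\<^bsub>singular_cochain_group X 2\<^esub> = \<one>\<^bsub>integer_functions (order_simplices P 2)\<^esub>"
    by (auto simp: singular_cochain_group_def integer_functions_simps restrict_cochain_def fun_eq_iff
        singular_simplex_realize)
  ultimately have "order_coboundary P 1 (restrict_cochain 1 c) = \<one>\<^bsub>integer_functions (order_simplices P 2)\<^esub>"
    using restrict_cochain_coboundary[of 1 c] by (simp add: numeral_2_eq_2)
  then show ?thesis
    using restrict_cochain_invariant[of 1 c] invariant_1_cocycle_iff[of "restrict_cochain 1 c"]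
    by (simp add: invariant_cocycles_def restrict_cochain_def)
qed

lemma restrict_cocycle_surj:
  assumes f: "f \<in> invariant_cocycles"
  obtains c where "c \<in> singular_cocycles" "restrict_cochain 1 c = f"
proof -
  have ext: "f \<in> order_simplices P 1 \<rightarrow>\<^sub>E UNIV"
    and inv: "\<And>g \<sigma>. g \<in> carrier G \<Longrightarrow> \<sigma> \<in> order_simplices P 1 \<Longrightarrow> f (map (\<phi> g) \<sigma>) = f \<sigma>"
    and cocycle: "\<And>u v w. u \<in> P \<Longrightarrow> v \<in> P \<Longrightarrow> w \<in> P \<Longrightarrow> u < v \<Longrightarrow> v < w \<Longrightarrow> f [u, v] + f [v, w] = f [u, w]"
    using f unfolding invariant_cocycles_def invariant_cochains_iff by blast+
  have "f [\<phi> g v, \<phi> g w] = f [v, w]" if "g \<in> carrier G" "v \<in> P" "w \<in> P" "v < w" for g v w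
    using inv[of g "[v, w]"] that order_simplices_01(2)[of v w P] by simp
  then obtain c where c: "singular_1_cocycle X c"
    "\<And>v w. v \<in> P \<Longrightarrow> w \<in> P \<Longrightarrow> v < w \<Longrightarrow> c (spoke v (vertex w)) = f [v, w]"
    using cocycle_with_given_edges[of "\<lambda>v w. f [v, w]"] cocycle by blast
  \<comment> \<open>Cochains are extensional functions, so the values off the simplices have to be reset.\<close>
  let ?c = "\<lambda>\<sigma> \<in> singular_simplex_set 1 X. c \<sigma>"
  have "singular_1_cocycle X ?c"
    using c(1) singular_simplex_singular_face[of 2 X] by (auto simp: singular_1_cocycle_def)
  moreover have "restrict_cochain 1 ?c \<sigma> = f \<sigma>" for \<sigma>
  proof (cases "\<sigma> \<in> order_simplices P 1")
    case True
    then obtain v w where \<sigma>: "\<sigma> = [v, w]" "v \<in> P" "w \<in> P" "v < w" by (rule order_simplices_1E)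
    have "singular_simplex 1 X (spoke v (vertex w))"
      using singular_simplex_realize[OF True] \<sigma> by (simp add: realize_edge)
    then show ?thesis using \<sigma> c(2) by (simp add: restrict_cochain_edge del: One_nat_def)
  next
    case False
    then show ?thesis using ext by (auto simp: restrict_cochain_def)
  qed
  ultimately show ?thesis
    by (intro that[of ?c]) (auto simp: singular_cocycles_def)
qed

lemma restrict_coboundary_iff:
  assumes c: "c \<in> singular_cocycles"
  shows "restrict_cochain 1 c \<in> invariant_coboundaries \<longleftrightarrow> c \<in> singular_coboundaries"
proof
  assume "c \<in> singular_coboundaries"
  then obtain b where "c = singular_coboundary X 0 b"
    by (auto simp: singular_coboundaries_def)
  then have "restrict_cochain 1 c = order_coboundary P 0 (restrict_cochain 0 b)"
    using restrict_cochain_coboundary[of 0 b] by simp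
  then show "restrict_cochain 1 c \<in> invariant_coboundaries"
    unfolding invariant_coboundaries_def using restrict_cochain_invariant by blast
next
  assume "restrict_cochain 1 c \<in> invariant_coboundaries"
  then obtain f where f: "f \<in> invariant_cochains 0" "restrict_cochain 1 c = order_coboundary P 0 f"
    by (auto simp: invariant_coboundaries_def)
  have ext: "c \<in> singular_simplex_set 1 X \<rightarrow>\<^sub>E UNIV" and cocycle: "singular_1_cocycle X c"
    using c by (auto simp: singular_cocycles_def)
  have edge: "c (spoke v (vertex w)) = f [w] - f [v]" if "v \<in> P" "w \<in> P" "v < w" for v w
    using that f(2) restrict_cochain_edge[of v w c] order_coboundary_edge[of v P w f] by simp
  have inv: "f [\<phi> g v] = f [v]" if "g \<in> carrier G" "v \<in> P" for g v
    using f(1) that order_simplices_01(1)[of v P] unfolding invariant_cochains_iff by fastforce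
  obtain \<beta> where \<beta>: "\<And>H. continuous_map (top_of_set {0..1::real}) X H \<Longrightarrow>
    c (line_simplex H 0 1) = \<beta> (H 1) - \<beta> (H 0)"
    using cocycle_is_coboundary_if_edges[OF cocycle, of "\<lambda>v. f [v]"] edge inv by blast
  define b where "b = (\<lambda>\<sigma> \<in> singular_simplex_set 0 X. \<beta> (\<sigma> (\<lambda>i. if i = 0 then 1 else 0)))"
  have b: "b (point_simplex y) = \<beta> y" if "y \<in> topspace X" for y
    using singular_simplex_point[OF that] by (simp add: b_def) (simp add: point_simplex_def)
  have "c \<sigma> = singular_coboundary X 0 b \<sigma>" for \<sigma>
  proof (cases "singular_simplex 1 X \<sigma>")
    case True
    then obtain H :: "real \<Rightarrow> ('v \<Rightarrow> real) set"
      where H: "continuous_map (top_of_set {0..1}) X H" "\<sigma> = line_simplex H 0 1"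
      by (rule singular_1_simplex_as_line)
    have "H 0 \<in> topspace X" "H 1 \<in> topspace X"
      using continuous_map_funspace[OF H(1)] by auto
    then show ?thesis
      using singular_coboundary_line[OF H(1), of 0 1 b] \<beta>[OF H(1)] H(2) b by simp
  next
    case False
    then show ?thesis using ext by (auto simp: singular_coboundary_def)
  qed
  then have "c = singular_coboundary X 0 b" ..
  moreover have "b \<in> singular_simplex_set 0 X \<rightarrow>\<^sub>E UNIV" by (simp add: b_def)
  ultimately show "c \<in> singular_coboundaries"
    unfolding singular_coboundaries_def by blast
qed

text \<open>The comparison map is a surjection from singular cocycles onto invariant cocycles
under which coboundaries correspond.\<close>

theorem invariant_cohomology_iso_orbit_space:
  "invariant_order_cohomology G \<phi> 1 P \<cong> singular_cohomology 1 X"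
proof -
  let ?Z = "(integer_functions (singular_simplex_set 1 X))\<lparr>carrier := singular_cocycles\<rparr>"
  let ?I = "(integer_functions (order_simplices P 1))\<lparr>carrier := invariant_cocycles\<rparr>"
  have "?Z Mod singular_coboundaries \<cong> ?I Mod invariant_coboundaries"
  proof (rule Mod_iso_Mod[OF normal_singular_coboundaries normal_invariant_coboundaries])
    show "restrict_cochain 1 \<in> hom ?Z ?I"
      using restrict_cochain_hom[of 1] restrict_cocycle
      by (auto simp: hom_def singular_cochain_group_def singular_cocycles_def integer_functions_simps(1))
    show "restrict_cochain 1 ` carrier ?Z = carrier ?I"
      using restrict_cocycle restrict_cocycle_surj by auto (metis imageI)
    show "restrict_cochain 1 c \<in> invariant_coboundaries \<longleftrightarrow> c \<in> singular_coboundaries"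
      if "c \<in> carrier ?Z" for c
      using restrict_coboundary_iff that by simp
  qed
  then show ?thesis
    unfolding singular_cohomology_1 invariant_cohomology_1
    by (rule group.iso_sym[OF normal.factorgroup_is_group[OF normal_singular_coboundaries]])
qed

end

section \<open>The conjugation action on elementary abelian subgroups\<close>

context group
begin

lemma conjugate_set_eq_image:
  "conjugate_set G g E = (\<lambda>x. g \<otimes> x \<otimes> inv g) ` E"
  by (auto simp: conjugate_set_def l_coset_def r_coset_def)

lemma conjugate_elementary_abelian:
  assumes g: "g \<in> carrier G" and E: "E \<in> elementary_abelian_subgroups_ge2 G p"
  shows "conjugate_set G g E \<in> elementary_abelian_subgroups_ge2 G p"
proof -
  have sub: "subgroup E G" using E by (simp add: elementary_abelian_subgroups_ge2_def)
  obtain r :: nat where r: "2 \<le> r" "G\<lparr>carrier := E\<rparr> \<cong> product_group {..<r} (\<lambda>_. integer_mod_group p)"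
    using E by (auto simp: elementary_abelian_subgroups_ge2_def elementary_abelian_of_rank_def)
  have [simp]: "x \<in> carrier G" if "x \<in> E" for x using sub that by (rule subgroup.mem_carrier)
  let ?c = "\<lambda>x. g \<otimes> x \<otimes> inv g"
  have "?c \<in> iso (G\<lparr>carrier := E\<rparr>) (G\<lparr>carrier := conjugate_set G g E\<rparr>)"
    unfolding iso_def hom_def
  proof (intro CollectI conjI ballI)
    show "bij_betw ?c (carrier (G\<lparr>carrier := E\<rparr>)) (carrier (G\<lparr>carrier := conjugate_set G g E\<rparr>))"
      using g by (auto simp: conjugate_set_eq_image bij_betw_def inj_on_def)
    show "?c (x \<otimes>\<^bsub>G\<lparr>carrier := E\<rparr>\<^esub> y) = ?c x \<otimes>\<^bsub>G\<lparr>carrier := conjugate_set G g E\<rparr>\<^esub> ?c y"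
      if "x \<in> carrier (G\<lparr>carrier := E\<rparr>)" "y \<in> carrier (G\<lparr>carrier := E\<rparr>)" for x y
    proof -
      have "inv g \<otimes> (g \<otimes> z) = z" if "z \<in> carrier G" for z
        using g that by (simp add: m_assoc[symmetric])
      then show ?thesis using g that by (simp add: m_assoc)
    qed
  qed (auto simp: conjugate_set_eq_image)
  then have "G\<lparr>carrier := E\<rparr> \<cong> G\<lparr>carrier := conjugate_set G g E\<rparr>" by (rule is_isoI)
  then have "G\<lparr>carrier := conjugate_set G g E\<rparr> \<cong> product_group {..<r} (\<lambda>_. integer_mod_group p)"
    by (rule iso_trans[OF group.iso_sym[OF subgroup.subgroup_is_group[OF sub is_group]] r(2)])
  moreover have "subgroup (conjugate_set G g E) G"
    unfolding conjugate_set_def using g sub by (rule subgroup_conjugation_is_surj2)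
  ultimately show ?thesis
    using r(1) by (auto simp: elementary_abelian_subgroups_ge2_def elementary_abelian_of_rank_def)
qed

lemma finite_poset_action_conjugation:
  assumes "finite (carrier G)"
  shows "finite_poset_action G (elementary_abelian_subgroups_ge2 G p) (conjugate_set G)"
proof unfold_locales
  let ?P = "elementary_abelian_subgroups_ge2 G p"
  have sub: "E \<subseteq> carrier G" if "E \<in> ?P" for E
    using that subgroup.subset by (auto simp: elementary_abelian_subgroups_ge2_def)
  show "finite ?P"
    using sub by (intro finite_subset[OF _ finite_Pow_iff[THEN iffD2, OF assms]]) auto
  show "conjugate_set G g E \<in> ?P" if "g \<in> carrier G" "E \<in> ?P" for g E
    using that by (rule conjugate_elementary_abelian)
  show "conjugate_set G \<one> E = E" if "E \<in> ?P" for E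
    using sub[OF that] by (force simp: conjugate_set_eq_image image_iff subset_iff)
  show "conjugate_set G (g \<otimes> h) E = conjugate_set G g (conjugate_set G h E)"
    if "g \<in> carrier G" "h \<in> carrier G" "E \<in> ?P" for g h E
    unfolding conjugate_set_eq_image image_image
    using that sub[OF that(3)] by (intro image_cong) (auto simp: m_assoc inv_mult_group subset_iff)
  show "conjugate_set G g E \<subseteq> conjugate_set G g F" if "E \<subseteq> F" for g E F
    using that by (auto simp: conjugate_set_eq_image)
qed

end

theorem lemma7p7:
  fixes G :: "('a, 'b) monoid_scheme" and p :: nat
  assumes "prime p"
    and "group G"
    and "finite (carrier G)"
    and "\<exists>m. order G = p ^ m"
  shows "invariant_order_cohomology G (conjugate_set G) 1 (elementary_abelian_subgroups_ge2 G p) \<cong>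
    singular_cohomology 1
      (orbit_space G
        (realization_action G (conjugate_set G) (elementary_abelian_subgroups_ge2 G p))
        (order_realization (elementary_abelian_subgroups_ge2 G p)))"
  using assms(2,3)
  by (intro finite_poset_action.invariant_cohomology_iso_orbit_space group.finite_poset_action_conjugation)

end
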